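(* Let $\lambda\in\mathcal M$ and $\mu$ be nonzero finite Borel measures on $S^{n-1}$ not concentrated on any closed hemisphere, and let $\Psi\in\mathscr G_I$. Then there exists $K\in\mathscr K^n_{(o)}$ with $\frac{\mu}{|\mu|}=\frac{\widetilde J_{\Psi,\lambda}(K,\cdot)}{\widetilde J_{\Psi,\lambda}(K,S^{n-1})}$. If in addition $\lambda$ is strictly positive on nonempty open subsets of $S^{n-1}$, then for a nonzero finite Borel measure $\mu$, being not concentrated on any closed hemisphere is also necessary for this equality to hold for some $K\in\mathscr K^n_{(o)}$.
   Context: $S^{n-1}$ unit sphere of $\mathbb R^n$, $n\ge2$, $d\xi$ spherical Lebesgue measure, $|\mu|=\mu(S^{n-1})$. $\mathscr K^n_{(o)}$: compact convex sets with the origin in their interior. For $K$: $h_K(x)=\max\{x\cdot y:y\in K\}$, $\rho_K(x)=\max\{t\ge0:tx\in K\}$; $\pmb\alpha_K(\xi)$ set of outer unit normals at $\rho_K(\xi)\xi$, singleton $\{\alpha_K(\xi)\}$ a.e.; $\pmb\alpha^*_K(\omega)=\{\xi:\pmb\alpha_K(\xi)\cap\omega\ne\emptyset\}$. $\mathscr G_I$: functions $\Psi:S^{n-1}\times(0,\infty)\to(0,\infty)$ with $\Psi$, $\Psi_t=\partial\Psi/\partial t$ continuous and, for each $u$, $\Psi_t(u,\cdot)>0$, $\lim_{t\to0^+}\Psi(u,t)=0$, $\lim_{t\to\infty}\Psi(u,t)=\infty$. $\mathcal M$: nonzero finite Borel measures absolutely continuous w.r.t. $d\xi$. $\widetilde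 J_{\Psi,\lambda}(K,\omega)=\int_{\pmb\alpha^*_K(\omega)}\frac{d\lambda(\xi)}{h_K(\alpha_K(\xi))\Psi_t(\alpha_K(\xi),h_K(\alpha_K(\xi)))}$. Not concentrated on any closed hemisphere: $\int(u\cdot\xi)_+d\mu(\xi)>0$ for all $u$. *)

theory Defs
  imports "HOL-Analysis.Analysis"
begin

abbreviation S :: "'a::euclidean_space set" where
  "S \<equiv> sphere 0 1"

abbreviation sphere_borel :: "'a::euclidean_space measure" where
  "sphere_borel \<equiv> restrict_space borel S"

text \<open>Spherical Lebesgue measure, via the cone construction:
  sigma(A) = n * Leb({x : 0 < |x| <= 1, x/|x| in A}).\<close>
definition spherical_measure :: "'a::euclidean_space measure" where
  "spherical_measure =
     scale_measure (of_nat DIM('a))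
       (distr (restrict_space lborel (cball 0 1 - {0})) sphere_borel (\<lambda>x. x /\<^sub>R norm x))"

definition finite_borel_sphere_measure :: "'a::euclidean_space measure \<Rightarrow> bool" where
  "finite_borel_sphere_measure \<mu> \<longleftrightarrow>
     sets \<mu> = sets sphere_borel \<and> space \<mu> = S \<and> finite_measure \<mu> \<and> emeasure \<mu> S \<noteq> 0"

definition class_M :: "'a::euclidean_space measure \<Rightarrow> bool" where
  "class_M lam \<longleftrightarrow> finite_borel_sphere_measure lam \<and> absolutely_continuous spherical_measure lam"

definition not_concentrated_on_hemisphere :: "'a::euclidean_space measure \<Rightarrow> bool" where
  "not_concentrated_on_hemisphere \<mu> \<longleftrightarrow>
     (\<forall>u\<in>S. (\<integral>\<xi>. max 0 (u \<bullet> \<xi>) \<partial>\<mu>) > 0)"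

definition convex_body_o :: "'a::euclidean_space set \<Rightarrow> bool" where
  "convex_body_o K \<longleftrightarrow> compact K \<and> convex K \<and> 0 \<in> interior K"

definition support_fun :: "'a::euclidean_space set \<Rightarrow> 'a \<Rightarrow> real" where
  "support_fun K x = (SUP y\<in>K. x \<bullet> y)"

definition radial_fun :: "'a::euclidean_space set \<Rightarrow> 'a \<Rightarrow> real" where
  "radial_fun K x = Sup {t. t \<ge> 0 \<and> t *\<^sub>R x \<in> K}"

definition radial_gauss_set :: "'a::euclidean_space set \<Rightarrow> 'a \<Rightarrow> 'a set" where
  "radial_gauss_set K \<xi> =
     {v\<in>S. \<forall>y\<in>K. v \<bullet> y \<le> v \<bullet> (radial_fun K \<xi> *\<^sub>R \<xi>)}"

text \<open>The (almost everywhere unique) outer unit normal; an arbitrary choice elsewhere.\<close>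
definition radial_gauss :: "'a::euclidean_space set \<Rightarrow> 'a \<Rightarrow> 'a" where
  "radial_gauss K \<xi> = (SOME v. v \<in> radial_gauss_set K \<xi>)"

definition reverse_radial_gauss :: "'a::euclidean_space set \<Rightarrow> 'a set \<Rightarrow> 'a set" where
  "reverse_radial_gauss K \<omega> = {\<xi>\<in>S. radial_gauss_set K \<xi> \<inter> \<omega> \<noteq> {}}"

definition class_G_I :: "('a::euclidean_space \<Rightarrow> real \<Rightarrow> real) \<Rightarrow> bool" where
  "class_G_I \<Psi> \<longleftrightarrow>
     (\<forall>u\<in>S. \<forall>t>0. \<Psi> u t > 0) \<and>
     continuous_on (S \<times> {0<..}) (\<lambda>(u,t). \<Psi> u t) \<and>
     (\<forall>u\<in>S. \<forall>t>0. \<Psi> u differentiable (at t)) \<and>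
     continuous_on (S \<times> {0<..}) (\<lambda>(u,t). deriv (\<Psi> u) t) \<and>
     (\<forall>u\<in>S. \<forall>t>0. deriv (\<Psi> u) t > 0) \<and>
     (\<forall>u\<in>S. (\<Psi> u \<longlongrightarrow> 0) (at_right 0)) \<and>
     (\<forall>u\<in>S. filterlim (\<Psi> u) at_top at_top)"

definition J_tilde :: "('a::euclidean_space \<Rightarrow> real \<Rightarrow> real) \<Rightarrow> 'a measure \<Rightarrow> 'a set \<Rightarrow> 'a set \<Rightarrow> real" where
  "J_tilde \<Psi> lam K \<omega> = enn2real (\<integral>\<^sup>+ \<xi>. indicator (reverse_radial_gauss K \<omega>) \<xi> *
      ennreal (1 / (support_fun K (radial_gauss K \<xi>) *
                    deriv (\<Psi> (radial_gauss K \<xi>)) (support_fun K (radial_gauss K \<xi>)))) \<partial>lam)"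

definition solves_problem :: "('a::euclidean_space \<Rightarrow> real \<Rightarrow> real) \<Rightarrow> 'a measure \<Rightarrow> 'a measure \<Rightarrow> 'a set \<Rightarrow> bool" where
  "solves_problem \<Psi> lam \<mu> K \<longleftrightarrow>
     (\<forall>\<omega>\<in>sets \<mu>. measure \<mu> \<omega> / measure \<mu> S = J_tilde \<Psi> lam K \<omega> / J_tilde \<Psi> lam K S)"

end

(*
  Writing f for a positive continuous function on the sphere and [f] for its Wulff shape,
  rho_[f](x) = min { f u / (u . x) : u . x > 0 } = 1 / polar_gauge f x. Under the variation
  f e^(s g), ln rho_[f] changes at rate g(alpha(x)). Hence a minimizer of the integral of
  ln (polar_gauge f) = - ln rho_[f] against lambda, subject to a bound on the integral of
  Psi u (f u) against mu, satisfies alpha_# lambda = const * f Psi_t(., f) mu, which is the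
  required equation. Since Psi -> oo, the constraint bounds [f] when mu is not concentrated on
  a hemisphere; if 0 came close to the boundary of [f], the energy would blow up, because
  lambda is not concentrated on one either. So Arzela-Ascoli applied to support functions
  yields a minimizer. Uniqueness a.e. of the normal needs no Rademacher theorem: kinks of the
  convex function polar_gauge f along the coordinate directions are null.

  Conversely, normals at boundary points in directions near u lie in the open hemisphere
  around u, so J_tilde charges every open hemisphere.
*)
theory Submission
  imports Defs "HOL-Complex_Analysis.Great_Picard"
begin

section \<open>Polar gauges and Wulff shapes\<close>

text \<open>\<open>polar_gauge f\<close> is the support function of the set of points
  \<open>u / f u\<close>, hence the Minkowski gauge of the Wulff shape. Unlike the radial function
  on the sphere it is convex and homogeneous on the whole space, and normals become maximizers of a
  quotient. Competitors are arbitrary positive continuous functions because a variation of a support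
  function is in general no longer one. This enlargement is harmless: the energy sees only the Wulff
  shape, while passing from f to the support function of its Wulff shape lowers f and with it,
  \<Psi> being increasing, the cost. Compactness relies on the same replacement, since a minimizing
  sequence itself need be neither bounded nor equicontinuous. As \<Psi> need not be homogeneous in
  t, dilation cannot normalise the constraint; it stays an inequality, and the multiplier is
  extracted from one-sided variations and constant shifts of g. A further obstacle is measurability:
  \<open>radial_gauss\<close> is a mere choice of normal. It is replaced by
  \<open>gauss_map\<close>, which agrees with it off a null set and whose coordinates are there
  limits of continuous difference quotients.\<close>

definition polar_gauge :: "('a::euclidean_space \<Rightarrow> real) \<Rightarrow> 'a \<Rightarrow> real" where
  "polar_gauge f x = (SUP u\<in>S. (u \<bullet> x) / f u)"

definition wulff :: "('a::euclidean_space \<Rightarrow> real) \<Rightarrow> 'a set" where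
  "wulff f = {x. \<forall>u\<in>S. u \<bullet> x \<le> f u}"

definition pos_cont :: "('a::euclidean_space \<Rightarrow> real) \<Rightarrow> bool" where
  "pos_cont f \<longleftrightarrow> continuous_on S f \<and> (\<forall>u\<in>S. f u > 0)"

lemma sphere_nonempty: "(S :: 'a::euclidean_space set) \<noteq> {}"
  by simp

lemma pos_cont_bounds:
  assumes "pos_cont (f :: 'a::euclidean_space \<Rightarrow> real)"
  obtains m M where "0 < m" "m \<le> M" "\<And>u. u \<in> S \<Longrightarrow> m \<le> f u" "\<And>u. u \<in> S \<Longrightarrow> f u \<le> M"
proof -
  have c: "continuous_on S f" using assms by (simp add: pos_cont_def)
  obtain a where a: "a \<in> S" "\<And>u. u \<in> S \<Longrightarrow> f a \<le> f u"
    using continuous_attains_inf[OF compact_sphere sphere_nonempty c] by blast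
  obtain b where b: "b \<in> S" "\<And>u. u \<in> S \<Longrightarrow> f u \<le> f b"
    using continuous_attains_sup[OF compact_sphere sphere_nonempty c] by blast
  show thesis using that[of "f a" "f b"] a b assms by (auto simp: pos_cont_def)
qed

text \<open>The maximizers play the role of outer normals in direction x; for support functions
  \<open>radial_gauss_set_iff\<close> makes this exact, and later arguments on normals are arguments
  on maximizers.\<close>

lemma polar_gauge_attained:
  fixes f :: "'a::euclidean_space \<Rightarrow> real"
  assumes "pos_cont f"
  obtains u where "u \<in> S" "polar_gauge f x = (u \<bullet> x) / f u"
    "\<And>v. v \<in> S \<Longrightarrow> (v \<bullet> x) / f v \<le> polar_gauge f x"
proof -
  have c: "continuous_on S (\<lambda>u. (u \<bullet> x) / f u)"
    using assms unfolding pos_cont_def by (intro continuous_intros) auto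
  obtain u where u: "u \<in> S" "\<And>v. v \<in> S \<Longrightarrow> (v \<bullet> x) / f v \<le> (u \<bullet> x) / f u"
    using continuous_attains_sup[OF compact_sphere sphere_nonempty c] by blast
  have "polar_gauge f x = (u \<bullet> x) / f u"
    unfolding polar_gauge_def using u by (intro cSup_eq_maximum) auto
  then show thesis using that u by simp
qed

lemma polar_gauge_ge:
  assumes "pos_cont f" "v \<in> S"
  shows "(v \<bullet> x) / f v \<le> polar_gauge f x"
  using polar_gauge_attained[OF assms(1)] assms(2) by metis

lemma polar_gauge_le:
  assumes "pos_cont f" "\<And>v. v \<in> S \<Longrightarrow> (v \<bullet> x) / f v \<le> c"
  shows "polar_gauge f x \<le> c"
  using polar_gauge_attained[OF assms(1)] assms(2) by metis

lemma polar_gauge_add: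
  assumes "pos_cont f"
  shows "polar_gauge f (x + y) \<le> polar_gauge f x + polar_gauge f y"
proof (rule polar_gauge_le[OF assms])
  fix v :: 'a assume v: "v \<in> S"
  show "v \<bullet> (x + y) / f v \<le> polar_gauge f x + polar_gauge f y"
    using polar_gauge_ge[OF assms v, of x] polar_gauge_ge[OF assms v, of y]
    by (simp add: inner_add_right add_divide_distrib)
qed

lemma polar_gauge_scale:
  assumes "pos_cont f" "t \<ge> 0"
  shows "polar_gauge f (t *\<^sub>R x) = t * polar_gauge f x"
proof (rule antisym)
  show "polar_gauge f (t *\<^sub>R x) \<le> t * polar_gauge f x"
  proof (rule polar_gauge_le[OF assms(1)])
    fix v :: 'a assume v: "v \<in> S"
    show "v \<bullet> (t *\<^sub>R x) / f v \<le> t * polar_gauge f x"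
      using mult_left_mono[OF polar_gauge_ge[OF assms(1) v, of x] assms(2)] by simp
  qed
  obtain u where u: "u \<in> S" "polar_gauge f x = (u \<bullet> x) / f u"
    using polar_gauge_attained[OF assms(1)] by metis
  show "t * polar_gauge f x \<le> polar_gauge f (t *\<^sub>R x)"
    using polar_gauge_ge[OF assms(1) u(1), of "t *\<^sub>R x"] u(2) by simp
qed

lemma polar_gauge_ge_norm:
  assumes "pos_cont f" "\<And>u. u \<in> S \<Longrightarrow> f u \<le> M"
  shows "norm x / M \<le> polar_gauge f x"
proof (cases "x = 0")
  case True
  then show ?thesis using polar_gauge_scale[OF assms(1), of 0 0] by simp
next
  case False
  let ?u = "x /\<^sub>R norm x"
  have u: "?u \<in> S" using False by simp
  have "0 < f ?u" "f ?u \<le> M" using assms u unfolding pos_cont_def by blast+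
  moreover have "?u \<bullet> x = norm x" using False by (simp add: dot_square_norm power2_eq_square)
  ultimately have "norm x / M \<le> (?u \<bullet> x) / f ?u"
    by (simp add: frac_le)
  also have "\<dots> \<le> polar_gauge f x" by (rule polar_gauge_ge[OF assms(1) u])
  finally show ?thesis .
qed

lemma polar_gauge_pos:
  assumes "pos_cont f" "x \<noteq> 0"
  shows "polar_gauge f x > 0"
proof -
  obtain m M where "0 < m" "m \<le> M" "\<And>u. u \<in> S \<Longrightarrow> f u \<le> M"
    using pos_cont_bounds[OF assms(1)] by metis
  then have "0 < norm x / M" "norm x / M \<le> polar_gauge f x"
    using assms polar_gauge_ge_norm[OF assms(1)] by auto
  then show ?thesis by linarith
qed

lemma polar_gauge_pos_sphere:
  assumes "pos_cont f" "x \<in> S"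
  shows "polar_gauge f x > 0"
proof (rule polar_gauge_pos[OF assms(1)])
  show "x \<noteq> 0" using assms(2) by auto
qed

lemma polar_gauge_le_norm:
  assumes "pos_cont f" "0 < m" "\<And>u. u \<in> S \<Longrightarrow> m \<le> f u"
  shows "polar_gauge f x \<le> norm x / m"
proof (rule polar_gauge_le[OF assms(1)])
  fix v :: 'a assume v: "v \<in> S"
  have "v \<bullet> x \<le> norm x" using norm_cauchy_schwarz[of v x] v by simp
  then show "(v \<bullet> x) / f v \<le> norm x / m"
    using assms(2) assms(3)[OF v] by (intro frac_le) auto
qed

lemma polar_gauge_convex:
  assumes "pos_cont f"
  shows "convex_on UNIV (polar_gauge f)"
proof (rule convex_onI)
  fix t :: real and x y :: 'a assume t: "0 < t" "t < 1"
  show "polar_gauge f ((1 - t) *\<^sub>R x + t *\<^sub>R y) \<le> (1 - t) * polar_gauge f x + t * polar_gauge f y"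
    using polar_gauge_add[OF assms, of "(1 - t) *\<^sub>R x" "t *\<^sub>R y"] t
    by (simp add: polar_gauge_scale[OF assms])
qed simp

lemma polar_gauge_continuous:
  assumes "pos_cont f"
  shows "continuous_on A (polar_gauge f)"
  using convex_on_continuous[OF open_UNIV polar_gauge_convex[OF assms]] continuous_on_subset by blast

text \<open>At a point of the sphere the maximum is positive, so its maximizer has positive inner
  product with x, and there dividing by a larger function gives a smaller quotient. The factor c is
  1 for comparing f with the support function of its Wulff shape, and 1 + \<epsilon> for uniformly
  close functions.\<close>

lemma polar_gauge_antimono:
  assumes "pos_cont f" "pos_cont g" "0 < c" "\<And>u. u \<in> S \<Longrightarrow> f u \<le> c * g u" "x \<in> S"
  shows "polar_gauge g x \<le> c * polar_gauge f x"
proof -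
  obtain u where u: "u \<in> S" "polar_gauge g x = (u \<bullet> x) / g u"
    using polar_gauge_attained[OF assms(2)] by metis
  have p: "polar_gauge g x > 0" by (rule polar_gauge_pos_sphere[OF assms(2,5)])
  have g: "0 < f u" "0 < g u" using u assms unfolding pos_cont_def by blast+
  have "u \<bullet> x > 0" using p g u(2) by (simp add: zero_less_divide_iff)
  then have "(u \<bullet> x) / g u \<le> c * ((u \<bullet> x) / f u)"
    using g assms(3) assms(4)[OF u(1)] by (simp add: field_simps)
  also have "\<dots> \<le> c * polar_gauge f x"
    using polar_gauge_ge[OF assms(1) u(1), of x] assms(3) by (intro mult_left_mono) auto
  finally show ?thesis using u by simp
qed

lemma wulff_iff:
  assumes "pos_cont f"
  shows "x \<in> wulff f \<longleftrightarrow> polar_gauge f x \<le> 1"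
proof
  assume "x \<in> wulff f"
  then show "polar_gauge f x \<le> 1"
    using assms by (intro polar_gauge_le[OF assms]) (auto simp: wulff_def pos_cont_def)
next
  assume a: "polar_gauge f x \<le> 1"
  have "u \<bullet> x \<le> f u" if u: "u \<in> S" for u
  proof -
    have "f u > 0" using u assms by (simp add: pos_cont_def)
    moreover have "(u \<bullet> x) / f u \<le> 1" using polar_gauge_ge[OF assms u, of x] a by linarith
    ultimately show ?thesis by simp
  qed
  then show "x \<in> wulff f" by (simp add: wulff_def)
qed

lemma convex_body_wulff:
  assumes "pos_cont f"
  shows "convex_body_o (wulff f)"
proof -
  obtain m M where m: "0 < m" "m \<le> M" "\<And>u. u \<in> S \<Longrightarrow> m \<le> f u" "\<And>u. u \<in> S \<Longrightarrow> f u \<le> M"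
    using pos_cont_bounds[OF assms] by metis
  have e: "wulff f = (\<Inter>u\<in>S. {x. u \<bullet> x \<le> f u})" by (auto simp: wulff_def)
  have "closed (wulff f)" unfolding e by (intro closed_INT ballI closed_halfspace_le)
  moreover have "bounded (wulff f)"
  proof -
    have "norm x \<le> M" if "x \<in> wulff f" for x
    proof -
      have "norm x / M \<le> 1"
        using that wulff_iff[OF assms, of x] polar_gauge_ge_norm[OF assms m(4), of x] by linarith
      moreover have "M > 0" using m by linarith
      ultimately show ?thesis by simp
    qed
    then show ?thesis by (auto simp: bounded_iff)
  qed
  moreover have "convex (wulff f)" unfolding e by (intro convex_INT ballI convex_halfspace_le)
  moreover have "ball 0 m \<subseteq> wulff f"
  proof
    fix x :: 'a assume x: "x \<in> ball 0 m"
    then have "norm x / m \<le> 1" using m by simp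
    then show "x \<in> wulff f"
      using wulff_iff[OF assms, of x] polar_gauge_le_norm[OF assms m(1,3), of x] by linarith
  qed
  then have "0 \<in> interior (wulff f)" using m(1) by (auto simp: mem_interior)
  ultimately show ?thesis by (simp add: convex_body_o_def compact_eq_bounded_closed)
qed

section \<open>Support functions of convex bodies and their Wulff shapes\<close>

lemma support_fun_attained:
  fixes K :: "'a::euclidean_space set"
  assumes "compact K" "K \<noteq> {}"
  obtains y where "y \<in> K" "support_fun K x = x \<bullet> y" "\<And>z. z \<in> K \<Longrightarrow> x \<bullet> z \<le> support_fun K x"
proof -
  have "continuous_on K (\<lambda>y. x \<bullet> y)" by (intro continuous_intros)
  then obtain y where y: "y \<in> K" "\<And>z. z \<in> K \<Longrightarrow> x \<bullet> z \<le> x \<bullet> y"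
    using continuous_attains_sup[OF assms, of "\<lambda>y. x \<bullet> y"] by blast
  have "support_fun K x = x \<bullet> y"
    unfolding support_fun_def using y by (intro cSup_eq_maximum) auto
  then show thesis using that y by simp
qed

lemma convex_body_nonempty: "convex_body_o K \<Longrightarrow> compact K \<and> K \<noteq> {}"
  by (auto simp: convex_body_o_def)

lemma support_fun_ge:
  assumes "convex_body_o K" "y \<in> K"
  shows "x \<bullet> y \<le> support_fun K x"
  using support_fun_attained[of K x] convex_body_nonempty[OF assms(1)] assms(2) by metis

text \<open>The constant depends on K only through a bounding radius, so support functions of
  uniformly bounded bodies are equicontinuous.\<close>

lemma support_fun_lipschitz:
  assumes "convex_body_o K" "\<And>y. y \<in> K \<Longrightarrow> norm y \<le> R"
  shows "\<bar>support_fun K u - support_fun K v\<bar> \<le> R * norm (u - v)"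
proof -
  have "support_fun K u \<le> support_fun K v + R * norm (u - v)" for u v
  proof -
    obtain y where y: "y \<in> K" "support_fun K u = u \<bullet> y"
      using support_fun_attained convex_body_nonempty[OF assms(1)] by metis
    have "u \<bullet> y = v \<bullet> y + (u - v) \<bullet> y" by (simp add: inner_diff_left)
    also have "v \<bullet> y \<le> support_fun K v" by (rule support_fun_ge[OF assms(1) y(1)])
    also have "(u - v) \<bullet> y \<le> norm (u - v) * norm y" by (rule norm_cauchy_schwarz)
    also have "\<dots> \<le> norm (u - v) * R" using assms(2)[OF y(1)] by (intro mult_left_mono) auto
    finally show ?thesis using y by (simp add: mult.commute)
  qed
  from this[of u v] this[of v u] show ?thesis by (simp add: norm_minus_commute abs_le_iff)
qed

lemma pos_cont_support_fun:
  assumes "convex_body_o K"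
  shows "pos_cont (support_fun K)"
proof -
  obtain R where R: "\<And>y. y \<in> K \<Longrightarrow> norm y \<le> R" "R > 0"
    using assms unfolding convex_body_o_def by (metis compact_imp_bounded bounded_pos)
  have "R-lipschitz_on S (support_fun K)"
    using support_fun_lipschitz[OF assms R(1)] R(2)
    by (intro lipschitz_onI) (auto simp: dist_norm)
  then have "continuous_on S (support_fun K)" by (rule lipschitz_on_continuous_on)
  moreover have "support_fun K u > 0" if u: "u \<in> S" for u
  proof -
    obtain e where e: "e > 0" "cball 0 e \<subseteq> K"
      using assms unfolding convex_body_o_def mem_interior_cball by blast
    have "e *\<^sub>R u \<in> K" using e u by (intro subsetD[OF e(2)]) simp
    then have "u \<bullet> (e *\<^sub>R u) \<le> support_fun K u" by (rule support_fun_ge[OF assms])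
    moreover have "u \<bullet> (e *\<^sub>R u) = e" using u by (simp add: dot_square_norm)
    ultimately show ?thesis using e by linarith
  qed
  ultimately show ?thesis by (simp add: pos_cont_def)
qed

lemma wulff_support_fun:
  assumes "convex_body_o K"
  shows "wulff (support_fun K) = K"
proof (intro equalityI subsetI)
  fix x assume x: "x \<in> wulff (support_fun K)"
  show "x \<in> K"
  proof (rule ccontr)
    assume "x \<notin> K"
    then obtain a b where ab: "a \<bullet> x < b" "\<And>y. y \<in> K \<Longrightarrow> a \<bullet> y > b"
      using separating_hyperplane_closed_point[of K x] assms
      unfolding convex_body_o_def by (auto simp: compact_imp_closed)
    have 0: "0 \<in> K" using assms interior_subset by (auto simp: convex_body_o_def)
    have "a \<noteq> 0" using ab(1) ab(2)[OF 0] by auto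
    \<comment> \<open>The separating functional is large on K and small at x, so the unit vector
      whose constraint excludes x is the reversed one.\<close>
    let ?u = "- a /\<^sub>R norm a"
    have u: "?u \<in> S" using \<open>a \<noteq> 0\<close> by simp
    obtain y where y: "y \<in> K" "support_fun K ?u = ?u \<bullet> y"
      using support_fun_attained convex_body_nonempty[OF assms] by metis
    have "?u \<bullet> x \<le> support_fun K ?u" using x u unfolding wulff_def by blast
    then have "?u \<bullet> x \<le> ?u \<bullet> y" using y(2) by linarith
    then have "a \<bullet> y \<le> a \<bullet> x" using \<open>a \<noteq> 0\<close> by (simp add: divide_inverse[symmetric] field_simps)
    then show False using ab(1) ab(2)[OF y(1)] by linarith
  qed
next
  fix x assume "x \<in> K"
  then show "x \<in> wulff (support_fun K)"
    using support_fun_ge[OF assms] by (auto simp: wulff_def)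
qed

lemma support_fun_wulff_le:
  assumes "pos_cont f" "u \<in> S"
  shows "support_fun (wulff f) u \<le> f u"
proof -
  have "convex_body_o (wulff f)" by (rule convex_body_wulff[OF assms(1)])
  then obtain y where "y \<in> wulff f" "support_fun (wulff f) u = u \<bullet> y"
    using support_fun_attained convex_body_nonempty by metis
  then show ?thesis using assms(2) by (auto simp: wulff_def)
qed

text \<open>The gauge depends on f only through its Wulff shape. This is what keeps the log energy
  unchanged when f is lowered to a support function.\<close>

lemma polar_gauge_support_fun_wulff:
  assumes "pos_cont f" "x \<in> S"
  shows "polar_gauge (support_fun (wulff f)) x = polar_gauge f x"
proof (rule antisym)
  let ?h = "support_fun (wulff f)"
  have b: "convex_body_o (wulff f)" by (rule convex_body_wulff[OF assms(1)])
  have h: "pos_cont ?h" by (rule pos_cont_support_fun[OF b])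
  show "polar_gauge f x \<le> polar_gauge ?h x"
    using polar_gauge_antimono[OF h assms(1), of 1 x] support_fun_wulff_le[OF assms(1)] assms(2) by simp
  have p: "polar_gauge f x > 0" by (rule polar_gauge_pos_sphere[OF assms])
  \<comment> \<open>This is the boundary point of the Wulff shape in direction x; evaluating the
    support function against it bounds every quotient.\<close>
  let ?y = "x /\<^sub>R polar_gauge f x"
  have y: "?y \<in> wulff f"
    using wulff_iff[OF assms(1)] p by (simp add: polar_gauge_scale[OF assms(1)])
  show "polar_gauge ?h x \<le> polar_gauge f x"
  proof (rule polar_gauge_le[OF h])
    fix v :: 'a assume v: "v \<in> S"
    have "?h v > 0" using h v by (simp add: pos_cont_def)
    moreover have "v \<bullet> ?y \<le> ?h v" by (rule support_fun_ge[OF b y])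
    ultimately show "v \<bullet> x / ?h v \<le> polar_gauge f x" using p by (simp add: field_simps)
  qed
qed

section \<open>Radial function and normals expressed by the gauge\<close>

lemma radial_fun_eq:
  assumes "convex_body_o K" "x \<in> S"
  shows "radial_fun K x = 1 / polar_gauge (support_fun K) x"
proof -
  have h: "pos_cont (support_fun K)" by (rule pos_cont_support_fun[OF assms(1)])
  have p: "polar_gauge (support_fun K) x > 0" by (rule polar_gauge_pos_sphere[OF h assms(2)])
  have "t *\<^sub>R x \<in> K \<longleftrightarrow> t * polar_gauge (support_fun K) x \<le> 1" if "t \<ge> 0" for t
    using wulff_iff[OF h, of "t *\<^sub>R x"] that
    by (simp add: polar_gauge_scale[OF h] wulff_support_fun[OF assms(1)])
  then have "{t. t \<ge> 0 \<and> t *\<^sub>R x \<in> K} = {0..1 / polar_gauge (support_fun K) x}"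
    using p by (auto simp: field_simps)
  then show ?thesis unfolding radial_fun_def using p by simp
qed

text \<open>The boundary point in direction x is x divided by the gauge N of x, and v is normal
  there iff its inner product with that point attains the support value: (v . x) / N x = h v.
  Solving for N x gives the maximizer condition.\<close>

lemma radial_gauss_set_iff:
  assumes "convex_body_o K" "x \<in> S"
  shows "v \<in> radial_gauss_set K x \<longleftrightarrow>
    v \<in> S \<and> (v \<bullet> x) / support_fun K v = polar_gauge (support_fun K) x"
proof (cases "v \<in> S")
  case True
  let ?h = "support_fun K"
  have h: "pos_cont ?h" by (rule pos_cont_support_fun[OF assms(1)])
  have p: "polar_gauge ?h x > 0" by (rule polar_gauge_pos_sphere[OF h assms(2)])
  have hv: "?h v > 0" using h True by (simp add: pos_cont_def)
  obtain y where y: "y \<in> K" "support_fun K v = v \<bullet> y"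
    using support_fun_attained convex_body_nonempty[OF assms(1)] by metis
  have "v \<in> radial_gauss_set K x \<longleftrightarrow> ?h v \<le> v \<bullet> (radial_fun K x *\<^sub>R x)"
    unfolding radial_gauss_set_def using True y support_fun_ge[OF assms(1), of _ v]
    by (auto intro: order_trans)
  also have "\<dots> \<longleftrightarrow> polar_gauge ?h x \<le> (v \<bullet> x) / ?h v"
    using p hv by (simp add: radial_fun_eq[OF assms] field_simps)
  also have "\<dots> \<longleftrightarrow> (v \<bullet> x) / ?h v = polar_gauge ?h x"
    using polar_gauge_ge[OF h True, of x] by auto
  finally show ?thesis using True by simp
qed (auto simp: radial_gauss_set_def)

lemma radial_gauss_mem:
  assumes "convex_body_o K" "x \<in> S"
  shows "radial_gauss K x \<in> radial_gauss_set K x"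
proof -
  have "\<exists>v. v \<in> radial_gauss_set K x"
    using polar_gauge_attained[OF pos_cont_support_fun[OF assms(1)], of x] radial_gauss_set_iff[OF assms]
    by metis
  then show ?thesis unfolding radial_gauss_def by (rule someI_ex)
qed

lemma radial_gauss_sphere:
  assumes "convex_body_o K" "x \<in> S"
  shows "radial_gauss K x \<in> S"
  using radial_gauss_mem[OF assms] by (simp add: radial_gauss_set_def)

section \<open>Almost everywhere uniqueness of the normal\<close>

text \<open>For convex \<open>N\<close>: the one-sided derivatives at \<open>x\<close> along \<open>e\<close> differ by at least \<open>d\<close>.\<close>
definition kinks :: "('a::euclidean_space \<Rightarrow> real) \<Rightarrow> 'a \<Rightarrow> real \<Rightarrow> 'a set" where
  "kinks N e d = {x. \<forall>s>0. d * s \<le> N (x + s *\<^sub>R e) + N (x - s *\<^sub>R e) - 2 * N x}"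

lemma closed_kinks:
  assumes "continuous_on UNIV N"
  shows "closed (kinks N e d)"
proof -
  have c: "continuous_on UNIV (\<lambda>x. N (g x))" if "continuous_on UNIV g" for g :: "'a \<Rightarrow> 'a"
    using continuous_on_compose2[OF assms that] by simp
  have "kinks N e d = (\<Inter>s\<in>{0<..}. {x. d * s \<le> N (x + s *\<^sub>R e) + N (x - s *\<^sub>R e) - 2 * N x})"
    by (auto simp: kinks_def)
  also have "closed \<dots>"
    using assms by (intro closed_INT ballI closed_Collect_le continuous_intros c)
  finally show ?thesis .
qed

section \<open>Translation of Lebesgue integrals and a test function\<close>

lemma integrable_lborel_compact_support:
  fixes f :: "'a::euclidean_space \<Rightarrow> real"
  assumes "continuous_on UNIV f" "\<And>x. x \<notin> cball 0 r \<Longrightarrow> f x = 0"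
  shows "integrable lborel f"
proof -
  have "integrable lborel (\<lambda>x. indicator (cball 0 r) x *\<^sub>R f x)"
    using assms(1) by (intro borel_integrable_compact) (auto intro: continuous_on_subset)
  also have "(\<lambda>x. indicator (cball 0 r) x *\<^sub>R f x) = f"
    using assms(2) by (auto simp: indicator_def fun_eq_iff)
  finally show ?thesis .
qed

lemma integral_lborel_translation:
  fixes f :: "'a::euclidean_space \<Rightarrow> real"
  assumes "f \<in> borel_measurable borel"
  shows "(\<integral>x. f (x + c) \<partial>lborel) = (\<integral>x. f x \<partial>lborel)"
proof -
  have "(\<integral>x. f x \<partial>lborel) = (\<integral>x. f x \<partial>(distr lborel borel ((+) c)))"
    by (simp add: lborel_distr_plus)
  also have "\<dots> = (\<integral>x. f (c + x) \<partial>lborel)"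
    using assms by (intro integral_distr) auto
  finally show ?thesis by (simp add: add.commute)
qed

text \<open>The squared positive part has derivative 2 max 0 a, which is Lipschitz with constant 2;
  hence the first-order Taylor remainder is at most the square of the increment.\<close>

lemma truncated_square_taylor:
  fixes a b :: real
  shows "\<bar>(max 0 (a + b))\<^sup>2 - (max 0 a)\<^sup>2 - 2 * max 0 a * b\<bar> \<le> b\<^sup>2"
proof -
  consider "a \<ge> 0" "a + b \<ge> 0" | "a \<ge> 0" "a + b < 0" | "a < 0" "a + b \<ge> 0" | "a < 0" "a + b < 0"
    by linarith
  then show ?thesis
  proof cases
    case 1 then show ?thesis by (simp add: max_def power2_eq_square algebra_simps)
  next
    case 2
    have "0 \<le> (a + b)\<^sup>2" by simp
    moreover have "a * (a + 2 * b) \<le> 0" using 2 by (intro mult_nonneg_nonpos) auto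
    ultimately show ?thesis using 2
      by (simp add: max_def power2_eq_square algebra_simps abs_le_iff)
  next
    case 3
    then have "(a + b)\<^sup>2 \<le> b\<^sup>2" by (intro power_mono) auto
    then show ?thesis using 3 by (simp add: max_def)
  next
    case 4 then show ?thesis by (simp add: max_def)
  qed
qed

text \<open>Squaring the truncation gives a Lipschitz gradient, enough for second differences of
  order \<open>s\<^sup>2\<close>. The support has radius 2, so the function stays above 1 on the
  unit ball, and shifts by at most 1 remain in radius 3.\<close>

definition bump :: "'a::euclidean_space \<Rightarrow> real" where
  "bump x = (max 0 (4 - x \<bullet> x))\<^sup>2"

lemma bump_continuous: "continuous_on UNIV (bump :: 'a::euclidean_space \<Rightarrow> real)"
  unfolding bump_def[abs_def] by (rule continuous_on_power[OF continuous_on_max[OF continuous_on_const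
    continuous_on_diff[OF continuous_on_const continuous_on_inner[OF continuous_on_id continuous_on_id]]]])

lemma bump_eq_0: "norm x \<ge> 2 \<Longrightarrow> bump x = 0"
proof -
  assume "norm x \<ge> 2"
  then have "2\<^sup>2 \<le> (norm x)\<^sup>2" by (intro power_mono) auto
  then show "bump x = 0" by (simp add: bump_def power2_norm_eq_inner)
qed

text \<open>The constant is 114 = 49 + 49 + 16. Inside radius 3 the increments b and c of the inner
  function are at most 6 s + s, so each Taylor remainder is at most 49 times the square of s. The
  first-order terms in x . e cancel, leaving 4 max 0 a times that square, where max 0 a is at most
  4.\<close>

lemma bump_second_difference:
  fixes x e :: "'a::euclidean_space"
  assumes "norm e = 1" "0 < s" "s \<le> 1"
  shows "\<bar>bump (x + s *\<^sub>R e) + bump (x - s *\<^sub>R e) - 2 * bump x\<bar> \<le> 114 * s\<^sup>2 * indicator (cball 0 3) x"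
proof (cases "norm x \<le> 3")
  case True
  define a where "a = 4 - x \<bullet> x"
  define b where "b = - 2 * s * (x \<bullet> e) - s\<^sup>2"
  define c where "c = 2 * s * (x \<bullet> e) - s\<^sup>2"
  have e1: "e \<bullet> e = 1" using assms(1) by (simp add: norm_eq_1)
  have B: "bump (x + s *\<^sub>R e) = (max 0 (a + b))\<^sup>2" "bump (x - s *\<^sub>R e) = (max 0 (a + c))\<^sup>2"
    "bump x = (max 0 a)\<^sup>2"
    unfolding bump_def a_def b_def c_def
    by (simp_all add: inner_add inner_diff e1 power2_eq_square inner_commute algebra_simps)
  have "\<bar>x \<bullet> e\<bar> \<le> 3" using Cauchy_Schwarz_ineq2[of x e] assms(1) True by simp
  then have xe: "s * \<bar>x \<bullet> e\<bar> \<le> s * 3" using assms(2) by (intro mult_left_mono) auto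
  have ss: "s\<^sup>2 \<le> s" using assms by (simp add: power2_eq_square mult_left_le)
  have "\<bar>b\<bar> \<le> 2 * (s * \<bar>x \<bullet> e\<bar>) + s\<^sup>2" "\<bar>c\<bar> \<le> 2 * (s * \<bar>x \<bullet> e\<bar>) + s\<^sup>2"
    using assms(2) unfolding b_def c_def
    by (auto simp: abs_mult intro!: order_trans[OF abs_triangle_ineq4])
  then have "\<bar>b\<bar> \<le> 7 * s" "\<bar>c\<bar> \<le> 7 * s" using xe ss by linarith+
  then have bc: "b\<^sup>2 \<le> 49 * s\<^sup>2" "c\<^sup>2 \<le> 49 * s\<^sup>2"
    using abs_le_square_iff[of b "7 * s"] abs_le_square_iff[of c "7 * s"] assms(2)
    by (auto simp: power_mult_distrib)
  have "2 * max 0 a * b + 2 * max 0 a * c = - 4 * max 0 a * s\<^sup>2"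
    by (simp add: b_def c_def algebra_simps)
  moreover have "max 0 a \<le> 4" by (simp add: a_def)
  then have "max 0 a * s\<^sup>2 \<le> 4 * s\<^sup>2" by (intro mult_right_mono) auto
  moreover have "0 \<le> max 0 a * s\<^sup>2" by simp
  ultimately have "\<bar>2 * max 0 a * b + 2 * max 0 a * c\<bar> \<le> 16 * s\<^sup>2" by linarith
  then have "\<bar>(max 0 (a + b))\<^sup>2 + (max 0 (a + c))\<^sup>2 - 2 * (max 0 a)\<^sup>2\<bar> \<le> 114 * s\<^sup>2"
  proof -
    have *: "\<bar>p + q - 2 * r\<bar> \<le> 114 * t" if "\<bar>p - r - y\<bar> \<le> 49 * t" "\<bar>q - r - z\<bar> \<le> 49 * t" "\<bar>y + z\<bar> \<le> 16 * t"
      for p q r y z t :: real using that by linarith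
    show ?thesis
      by (rule *[OF order_trans[OF truncated_square_taylor bc(1)] order_trans[OF truncated_square_taylor bc(2)]]) fact
  qed
  then show ?thesis using True by (simp add: B)
next
  case False
  have "norm x \<le> norm (x + s *\<^sub>R e) + norm (s *\<^sub>R e)" "norm x \<le> norm (x - s *\<^sub>R e) + norm (s *\<^sub>R e)"
    using norm_triangle_ineq4[of "x + s *\<^sub>R e" "s *\<^sub>R e"] norm_triangle_ineq[of "x - s *\<^sub>R e" "s *\<^sub>R e"]
    by simp_all
  then have "norm (x + s *\<^sub>R e) \<ge> 2" "norm (x - s *\<^sub>R e) \<ge> 2"
    using assms False by simp_all
  then show ?thesis using False by (simp add: bump_eq_0)
qed

text \<open>Translation invariance moves the second difference of \<open>N\<close> onto the test function
  \<open>bump\<close>, where it is of order \<open>s\<^sup>2\<close>; on the kinks it is of order \<open>s\<close>.\<close>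
lemma kinks_null:
  fixes N :: "'a::euclidean_space \<Rightarrow> real"
  assumes N: "convex_on UNIV N" and e: "norm e = 1" and d: "d > 0"
  shows "kinks N e d \<inter> cball 0 1 \<in> null_sets lborel"
proof -
  have cN: "continuous_on UNIV N" using convex_on_continuous[OF open_UNIV N] .
  have cN': "continuous_on UNIV (\<lambda>x. N (g x))" "continuous_on UNIV (\<lambda>x. bump (g x))"
    if "continuous_on UNIV g" for g :: "'a \<Rightarrow> 'a"
    using continuous_on_compose2[OF cN that] continuous_on_compose2[OF bump_continuous that] by auto
  let ?B = "kinks N e d \<inter> cball 0 1"
  have "compact ?B" using closed_kinks[OF cN] by (simp add: closed_Int_compact)
  then have Bs: "?B \<in> sets lborel" "emeasure lborel ?B < \<infinity>"
    by (auto simp: borel_compact less_top[symmetric] dest: emeasure_compact_finite)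
  obtain M where M: "M \<ge> 0" "\<And>x. x \<in> cball 0 3 \<Longrightarrow> \<bar>N x\<bar> \<le> M"
  proof -
    have "compact (N ` cball 0 3)"
      using cN by (intro compact_continuous_image) (auto intro: continuous_on_subset)
    then obtain b where "b > 0" "\<forall>y\<in>N ` cball 0 3. norm y \<le> b"
      using compact_imp_bounded bounded_pos by metis
    then show thesis using that[of b] by auto
  qed
  let ?V = "measure lborel (cball (0::'a) 3)"
  have main: "d * measure lborel ?B \<le> 114 * M * ?V * s" if s: "0 < s" "s \<le> 1" for s
  proof -
    let ?D = "\<lambda>x. N (x + s *\<^sub>R e) + N (x - s *\<^sub>R e) - 2 * N x"
    let ?Q = "\<lambda>x. bump (x + s *\<^sub>R e) + bump (x - s *\<^sub>R e) - 2 * bump x"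
    have Dnn: "?D x \<ge> 0" for x
    proof -
      have "N ((1 - 1/2) *\<^sub>R (x + s *\<^sub>R e) + (1/2) *\<^sub>R (x - s *\<^sub>R e)) \<le> (1 - 1/2) * N (x + s *\<^sub>R e) + (1/2) * N (x - s *\<^sub>R e)"
        by (rule convex_onD[OF N]) auto
      moreover have "(1 - 1/2) *\<^sub>R (x + s *\<^sub>R e) + (1/2) *\<^sub>R (x - s *\<^sub>R e) = x"
        by (simp add: algebra_simps flip: scaleR_add_left)
      ultimately show ?thesis by simp
    qed
    have far: "norm x - 1 \<le> norm (x + s *\<^sub>R e)" "norm x - 1 \<le> norm (x - s *\<^sub>R e)" for x
    proof -
      have "norm x \<le> norm (x + s *\<^sub>R e) + norm (s *\<^sub>R e)" "norm x \<le> norm (x - s *\<^sub>R e) + norm (s *\<^sub>R e)"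
        using norm_triangle_ineq4[of "x + s *\<^sub>R e" "s *\<^sub>R e"] norm_triangle_ineq[of "x - s *\<^sub>R e" "s *\<^sub>R e"]
        by simp_all
      then show "norm x - 1 \<le> norm (x + s *\<^sub>R e)" "norm x - 1 \<le> norm (x - s *\<^sub>R e)"
        using s e by simp_all
    qed
    have far0: "bump (x + s *\<^sub>R e) = 0" "bump (x - s *\<^sub>R e) = 0" "bump x = 0" if "x \<notin> cball 0 3" for x
      using that far[of x] by (auto intro!: bump_eq_0)
    note ci = continuous_intros cN' bump_continuous cN
    have I: "integrable lborel (\<lambda>x. bump x * N (x + s *\<^sub>R e))"
      "integrable lborel (\<lambda>x. bump x * N (x - s *\<^sub>R e))"
      "integrable lborel (\<lambda>x. bump x * N x)"
      "integrable lborel (\<lambda>x. bump (x - s *\<^sub>R e) * N x)"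
      "integrable lborel (\<lambda>x. bump (x + s *\<^sub>R e) * N x)"
      using far0 by (auto intro!: integrable_lborel_compact_support[where r = 3] ci)
    have t1: "(\<integral>x. bump x * N (x + s *\<^sub>R e) \<partial>lborel) = (\<integral>x. bump (x - s *\<^sub>R e) * N x \<partial>lborel)"
      using integral_lborel_translation[of "\<lambda>x. bump (x - s *\<^sub>R e) * N x" "s *\<^sub>R e"]
      by (simp add: borel_measurable_continuous_onI ci)
    have t2: "(\<integral>x. bump x * N (x - s *\<^sub>R e) \<partial>lborel) = (\<integral>x. bump (x + s *\<^sub>R e) * N x \<partial>lborel)"
      using integral_lborel_translation[of "\<lambda>x. bump (x + s *\<^sub>R e) * N x" "- s *\<^sub>R e"]
      by (simp add: borel_measurable_continuous_onI ci)
    have IB: "integrable lborel (\<lambda>x. d * s * indicator ?B x)"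
      using Bs by (intro integrable_mult_right integrable_real_indicator)
    have IC: "integrable lborel (\<lambda>x. 114 * s\<^sup>2 * M * indicator (cball (0::'a) 3) x)"
      by (intro integrable_mult_right integrable_real_indicator) (use emeasure_bounded_finite[OF bounded_cball] in auto)
    have "d * s * measure lborel ?B = (\<integral>x. d * s * indicator ?B x \<partial>lborel)"
      using Bs by simp
    also have "\<dots> \<le> (\<integral>x. bump x * N (x + s *\<^sub>R e) + bump x * N (x - s *\<^sub>R e) - 2 * (bump x * N x) \<partial>lborel)"
    proof (rule integral_mono[OF IB])
      show "integrable lborel (\<lambda>x. bump x * N (x + s *\<^sub>R e) + bump x * N (x - s *\<^sub>R e) - 2 * (bump x * N x))"
        using I by auto
      fix x
      have b: "bump x * N (x + s *\<^sub>R e) + bump x * N (x - s *\<^sub>R e) - 2 * (bump x * N x) = bump x * ?D x"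
        by (simp add: algebra_simps)
      show "d * s * indicator ?B x \<le> bump x * N (x + s *\<^sub>R e) + bump x * N (x - s *\<^sub>R e) - 2 * (bump x * N x)"
      proof (cases "x \<in> ?B")
        case True
        then have "d * s \<le> ?D x" using s by (auto simp: kinks_def)
        moreover have "1 \<le> bump x"
        proof -
          have "x \<bullet> x \<le> 1" using True by (simp add: power2_norm_eq_inner[symmetric] power_le_one)
          then have "1\<^sup>2 \<le> (max 0 (4 - x \<bullet> x))\<^sup>2" by (intro power_mono) auto
          then show ?thesis by (simp add: bump_def)
        qed
        moreover have "1 * ?D x \<le> bump x * ?D x" using calculation(2) Dnn by (rule mult_right_mono)
        ultimately show ?thesis unfolding b using True by simp
      next
        case False
        have "0 \<le> bump x * ?D x" using Dnn by (simp add: bump_def)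
        then show ?thesis unfolding b using False by simp
      qed
    qed
    also have "\<dots> = (\<integral>x. bump (x - s *\<^sub>R e) * N x + bump (x + s *\<^sub>R e) * N x - 2 * (bump x * N x) \<partial>lborel)"
      using I t1 t2 by simp
    also have "\<dots> \<le> (\<integral>x. 114 * s\<^sup>2 * M * indicator (cball (0::'a) 3) x \<partial>lborel)"
    proof (rule integral_mono[OF _ IC])
      show "integrable lborel (\<lambda>x. bump (x - s *\<^sub>R e) * N x + bump (x + s *\<^sub>R e) * N x - 2 * (bump x * N x))"
        using I by auto
      fix x
      have "bump (x - s *\<^sub>R e) * N x + bump (x + s *\<^sub>R e) * N x - 2 * (bump x * N x) = ?Q x * N x"
        by (simp add: algebra_simps)
      also have "\<dots> \<le> \<bar>?Q x\<bar> * \<bar>N x\<bar>" by (simp flip: abs_mult)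
      also have "\<dots> \<le> 114 * s\<^sup>2 * indicator (cball 0 3) x * \<bar>N x\<bar>"
        by (intro mult_right_mono bump_second_difference e s) auto
      also have "\<dots> \<le> 114 * s\<^sup>2 * M * indicator (cball (0::'a) 3) x"
        using M(2)[of x] by (auto simp: indicator_def mult_left_mono)
      finally show "bump (x - s *\<^sub>R e) * N x + bump (x + s *\<^sub>R e) * N x - 2 * (bump x * N x) \<le> 114 * s\<^sup>2 * M * indicator (cball (0::'a) 3) x" .
    qed
    also have "\<dots> = s * (114 * M * ?V * s)"
      by (simp add: power2_eq_square)
    finally have "s * (d * measure lborel ?B) \<le> s * (114 * M * ?V * s)"
      by (simp add: mult_ac)
    then show ?thesis using s by simp
  qed
  have "measure lborel ?B = 0"
  proof (rule ccontr)
    assume "measure lborel ?B \<noteq> 0"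
    then have p: "0 < d * measure lborel ?B" using d by (simp add: zero_less_measure_iff)
    let ?C = "114 * M * ?V"
    \<comment> \<open>The step is chosen so small that the upper bound \<open>?C * s\<close> falls
      below \<open>d * measure lborel ?B\<close>, against \<open>main\<close>; the summand 1 keeps
      the denominator positive when \<open>?C\<close> is 0.\<close>
    define s where "s = min 1 (d * measure lborel ?B / (2 * (?C + 1)))"
    have C: "0 \<le> ?C" using M by simp
    have s: "0 < s" "s \<le> 1" using p C by (auto simp: s_def)
    have "?C * s \<le> ?C * (d * measure lborel ?B / (2 * (?C + 1)))"
      using C by (intro mult_left_mono) (auto simp: s_def)
    also have "\<dots> < d * measure lborel ?B"
    proof -
      have "c * (y / (2 * (c + 1))) < y" if "0 \<le> c" "0 < y" for c y :: real
      proof -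
        have "0 \<le> c * y" using that by simp
        then have "c * y < y * (2 * (c + 1))" using that by (simp add: algebra_simps add_nonneg_pos)
        then show ?thesis using that by (simp add: pos_divide_less_eq)
      qed
      then show ?thesis using C p by blast
    qed
    finally show False using main[OF s] by simp
  qed
  then show ?thesis using Bs emeasure_eq_ennreal_measure[of lborel ?B] by (auto simp: null_sets_def)
qed

text \<open>Since A is a cone, a nonzero point whose direction lies in A lies in A itself. The cone
  over the directions is therefore inside the null set assumed in the ball.\<close>

lemma spherical_measure_null:
  fixes A :: "'a::euclidean_space set"
  assumes "A \<in> sets borel" "\<And>x t. x \<in> A \<Longrightarrow> 0 < t \<Longrightarrow> t *\<^sub>R x \<in> A" "A \<inter> cball 0 1 \<in> null_sets lborel"
  shows "A \<inter> S \<in> null_sets spherical_measure"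
proof -
  let ?M = "restrict_space lborel (cball 0 1 - {0::'a})"
  have sb: "A \<inter> S \<in> sets sphere_borel"
    using assms(1) by (auto simp: sets_restrict_space)
  have meas: "(\<lambda>x. x /\<^sub>R norm x) \<in> ?M \<rightarrow>\<^sub>M sphere_borel"
  proof (rule measurable_restrict_space2)
    show "(\<lambda>x. x /\<^sub>R norm x) \<in> space ?M \<rightarrow> S"
      by (auto simp: space_restrict_space)
    show "(\<lambda>x::'a. x /\<^sub>R norm x) \<in> borel_measurable ?M"
      by (rule measurable_restrict_space1) simp
  qed
  let ?P = "(\<lambda>x. x /\<^sub>R norm x) -` (A \<inter> S) \<inter> space ?M"
  have P1: "?P \<subseteq> A \<inter> cball 0 1"
  proof
    fix x assume x: "x \<in> ?P"
    then have "x /\<^sub>R norm x \<in> A" "x \<noteq> 0" "norm x \<le> 1" by (auto simp: space_restrict_space)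
    then show "x \<in> A \<inter> cball 0 1" using assms(2)[of "x /\<^sub>R norm x" "norm x"] by simp
  qed
  have "emeasure ?M ?P = emeasure lborel ?P"
    using P1 by (intro emeasure_restrict_space) (auto simp: space_restrict_space)
  also have "\<dots> = 0"
  proof -
    have "emeasure lborel ?P \<le> emeasure lborel (A \<inter> cball 0 1)"
      using P1 assms(3) by (intro emeasure_mono) auto
    then show ?thesis using assms(3) by (auto simp: null_sets_def)
  qed
  finally have "emeasure (distr ?M sphere_borel (\<lambda>x. x /\<^sub>R norm x)) (A \<inter> S) = 0"
    using emeasure_distr[OF meas sb] by simp
  then show ?thesis unfolding spherical_measure_def null_sets_def
    using sb by simp
qed

text \<open>Coordinate axes suffice because two distinct subgradients of the gauge differ in some
  coordinate. The thresholds 1 / (k + 1) exhaust all positive jumps by countably many sets.\<close>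

definition bad_directions :: "'a::euclidean_space set \<Rightarrow> 'a set" where
  "bad_directions K = (\<Union>e\<in>Basis. \<Union>k::nat. kinks (polar_gauge (support_fun K)) e (1 / Suc k)) \<inter> S"

text \<open>By homogeneity of the gauge, step s at t x corresponds to step s / t at x, and both
  sides of the kink inequality scale alike. Each kink set is thus a cone, and nullity in the ball
  passes to the sphere.\<close>

lemma bad_directions_null:
  assumes "convex_body_o K"
  shows "bad_directions K \<in> null_sets spherical_measure"
proof -
  let ?N = "polar_gauge (support_fun K)"
  have h: "pos_cont (support_fun K)" by (rule pos_cont_support_fun[OF assms])
  have "kinks ?N e (1 / Suc k) \<inter> S \<in> null_sets spherical_measure" if e: "e \<in> Basis" for e k
  proof (rule spherical_measure_null)
    show "kinks ?N e (1 / Suc k) \<in> sets borel"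
      using closed_kinks[OF polar_gauge_continuous[OF h]] by (simp add: borel_closed)
    show "kinks ?N e (1 / Suc k) \<inter> cball 0 1 \<in> null_sets lborel"
      using e by (intro kinks_null polar_gauge_convex[OF h]) auto
    fix x t assume x: "x \<in> kinks ?N e (1 / Suc k)" and t: "0 < (t::real)"
    show "t *\<^sub>R x \<in> kinks ?N e (1 / Suc k)"
      unfolding kinks_def
    proof (intro CollectI allI impI)
      fix s :: real assume s: "0 < s"
      have "t *\<^sub>R x + s *\<^sub>R e = t *\<^sub>R (x + (s / t) *\<^sub>R e)" "t *\<^sub>R x - s *\<^sub>R e = t *\<^sub>R (x - (s / t) *\<^sub>R e)"
        using t by (simp_all add: algebra_simps)
      then have "?N (t *\<^sub>R x + s *\<^sub>R e) + ?N (t *\<^sub>R x - s *\<^sub>R e) - 2 * ?N (t *\<^sub>R x)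
        = t * (?N (x + (s / t) *\<^sub>R e) + ?N (x - (s / t) *\<^sub>R e) - 2 * ?N x)"
        using t by (simp only: polar_gauge_scale[OF h less_imp_le[OF t]]) (simp add: algebra_simps)
      moreover have "1 / Suc k * (s / t) \<le> ?N (x + (s / t) *\<^sub>R e) + ?N (x - (s / t) *\<^sub>R e) - 2 * ?N x"
        using x divide_pos_pos[OF s t] unfolding kinks_def by blast
      then have "t * (1 / Suc k * (s / t)) \<le> t * (?N (x + (s / t) *\<^sub>R e) + ?N (x - (s / t) *\<^sub>R e) - 2 * ?N x)"
        using t by (intro mult_left_mono) auto
      ultimately show "1 / Suc k * s \<le> ?N (t *\<^sub>R x + s *\<^sub>R e) + ?N (t *\<^sub>R x - s *\<^sub>R e) - 2 * ?N (t *\<^sub>R x)"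
        using t by simp
    qed
  qed
  then have "(\<Union>e\<in>Basis. \<Union>k::nat. kinks ?N e (1 / Suc k) \<inter> S) \<in> null_sets spherical_measure"
    by (intro null_sets_UN' null_sets_UN) (auto simp: countable_finite)
  also have "(\<Union>e\<in>Basis. \<Union>k::nat. kinks ?N e (1 / Suc k) \<inter> S) = bad_directions K"
    by (auto simp: bad_directions_def)
  finally show ?thesis .
qed

text \<open>A normal v yields the subgradient v / h v of the gauge at x. If two of them differ in a
  coordinate, using one for the forward step and the other for the backward step bounds the jump of
  the one-sided derivatives below by that difference, so x is a kink.\<close>

lemma radial_gauss_set_singleton:
  assumes K: "convex_body_o K" and x: "x \<in> S" "x \<notin> bad_directions K"
    and v: "v \<in> radial_gauss_set K x" and w: "w \<in> radial_gauss_set K x"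
  shows "v = w"
proof (rule ccontr)
  let ?h = "support_fun K"
  let ?N = "polar_gauge ?h"
  have h: "pos_cont ?h" by (rule pos_cont_support_fun[OF K])
  assume "v \<noteq> w"
  have *: False if v: "v \<in> radial_gauss_set K x" and w: "w \<in> radial_gauss_set K x"
    and e: "e \<in> Basis" and l: "(w /\<^sub>R ?h w) \<bullet> e < (v /\<^sub>R ?h v) \<bullet> e" for v w e
  proof -
    have vS: "v \<in> S" "w \<in> S" using v w by (auto simp: radial_gauss_set_def)
    define p where "p = v /\<^sub>R ?h v"
    define q where "q = w /\<^sub>R ?h w"
    have N: "p \<bullet> y \<le> ?N y" "q \<bullet> y \<le> ?N y" for y
      using polar_gauge_ge[OF h, of v y] polar_gauge_ge[OF h, of w y] vS
      by (simp_all add: p_def q_def divide_inverse mult.commute)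
    have Nx: "?N x = p \<bullet> x" "?N x = q \<bullet> x"
      using v w radial_gauss_set_iff[OF K x(1)] by (simp_all add: p_def q_def divide_inverse mult.commute)
    obtain k where k: "1 / Suc k < p \<bullet> e - q \<bullet> e"
      using nat_approx_posE[of "p \<bullet> e - q \<bullet> e"] l by (auto simp: p_def q_def)
    have "x \<in> kinks ?N e (1 / Suc k)"
      unfolding kinks_def
    proof (intro CollectI allI impI)
      fix s :: real assume s: "0 < s"
      have "1 / Suc k * s \<le> (p \<bullet> e - q \<bullet> e) * s" using k s by (intro mult_right_mono) auto
      also have "\<dots> = p \<bullet> (x + s *\<^sub>R e) + q \<bullet> (x - s *\<^sub>R e) - 2 * ?N x"
        using Nx by (simp add: inner_add_right inner_diff_right algebra_simps)
      also have "\<dots> \<le> ?N (x + s *\<^sub>R e) + ?N (x - s *\<^sub>R e) - 2 * ?N x"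
        using N(1)[of "x + s *\<^sub>R e"] N(2)[of "x - s *\<^sub>R e"] by linarith
      finally show "1 / Suc k * s \<le> ?N (x + s *\<^sub>R e) + ?N (x - s *\<^sub>R e) - 2 * ?N x" .
    qed
    then show False using x e by (auto simp: bad_directions_def)
  qed
  have S: "v \<in> S" "w \<in> S" using v w by (auto simp: radial_gauss_set_def)
  have hp: "?h v > 0" "?h w > 0" using h S by (auto simp: pos_cont_def)
  \<comment> \<open>As v and w are unit vectors, the norm of each scaled vector recovers the support
    value, and hence the vector itself.\<close>
  have "v /\<^sub>R ?h v \<noteq> w /\<^sub>R ?h w"
  proof
    assume eq: "v /\<^sub>R ?h v = w /\<^sub>R ?h w"
    then have "norm (v /\<^sub>R ?h v) = norm (w /\<^sub>R ?h w)" by simp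
    then have "?h v = ?h w" using S hp by simp
    then show False using eq hp \<open>v \<noteq> w\<close> by simp
  qed
  then obtain e where e: "e \<in> Basis" "(v /\<^sub>R ?h v) \<bullet> e \<noteq> (w /\<^sub>R ?h w) \<bullet> e"
    using euclidean_eqI by metis
  then show False using *[OF v w e(1)] *[OF w v e(1)] by linarith
qed

section \<open>First variation of the log energy\<close>

lemma borel_measurable_continuous_on_sphere:
  fixes f :: "'a::euclidean_space \<Rightarrow> 'b::topological_space"
  assumes "finite_borel_sphere_measure M" "continuous_on S f"
  shows "f \<in> borel_measurable M"
proof -
  have "sets M = sets (sphere_borel :: 'a measure)"
    using assms(1) by (simp add: finite_borel_sphere_measure_def)
  then show ?thesis
    using borel_measurable_continuous_on_restrict[OF assms(2)] measurable_cong_sets by blast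
qed

lemma continuous_on_sphere_bounded:
  fixes f :: "'a::euclidean_space \<Rightarrow> real"
  assumes "continuous_on S f"
  obtains B where "B > 0" "\<And>x. x \<in> S \<Longrightarrow> \<bar>f x\<bar> \<le> B"
proof -
  have "compact (f ` S)" using assms by (intro compact_continuous_image) auto
  then obtain b where "b > 0" "\<forall>y\<in>f ` S. norm y \<le> b"
    using compact_imp_bounded bounded_pos by metis
  then show thesis using that[of b] by auto
qed

lemma integrable_continuous_on_sphere:
  fixes f :: "'a::euclidean_space \<Rightarrow> real"
  assumes "finite_borel_sphere_measure M" "continuous_on S f"
  shows "integrable M f"
proof -
  interpret finite_measure M using assms(1) by (simp add: finite_borel_sphere_measure_def)
  obtain B where "\<And>x. x \<in> S \<Longrightarrow> \<bar>f x\<bar> \<le> B"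
    using continuous_on_sphere_bounded[OF assms(2)] by metis
  then have "AE x in M. norm (f x) \<le> B"
    using assms(1) by (intro AE_I2) (auto simp: finite_borel_sphere_measure_def)
  then show ?thesis
    using borel_measurable_continuous_on_sphere[OF assms] by (rule integrable_const_bound)
qed

lemma sets_open_cap:
  assumes "finite_borel_sphere_measure M"
  shows "{u\<in>S. c < v \<bullet> u} \<in> sets M"
proof -
  have "(\<lambda>u. v \<bullet> u) \<in> borel_measurable M"
    by (intro borel_measurable_continuous_on_sphere[OF assms] continuous_intros)
  then have "{u\<in>space M. c < v \<bullet> u} \<in> sets M" by simp
  then show ?thesis using assms by (simp add: finite_borel_sphere_measure_def)
qed

lemma continuous_on_ln_polar_gauge:
  assumes "pos_cont f"
  shows "continuous_on S (\<lambda>x. ln (polar_gauge f x))"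
proof (rule continuous_on_ln[OF polar_gauge_continuous[OF assms]], rule ballI)
  fix x :: 'a assume "x \<in> S"
  then show "polar_gauge f x \<noteq> 0" using polar_gauge_pos_sphere[OF assms] by (simp add: less_imp_neq[symmetric])
qed

lemma inner_pos_of_attained:
  assumes "pos_cont f" "x \<in> S" "u \<in> S" "polar_gauge f x = (u \<bullet> x) / f u"
  shows "u \<bullet> x > 0"
proof -
  have "f u > 0" using assms by (simp add: pos_cont_def)
  then show ?thesis using polar_gauge_pos_sphere[OF assms(1,2)] assms(4) by (simp add: zero_less_divide_iff)
qed

text \<open>An exponential factor preserves positivity for every continuous g and every s, and it
  shifts the logarithm of the quotient at u by exactly - s g u.\<close>

definition log_variation :: "('a::euclidean_space \<Rightarrow> real) \<Rightarrow> ('a \<Rightarrow> real) \<Rightarrow> real \<Rightarrow> 'a \<Rightarrow> real" where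
  "log_variation h g s = (\<lambda>u. h u * exp (s * g u))"

lemma pos_cont_log_variation:
  assumes "pos_cont h" "continuous_on S g"
  shows "pos_cont (log_variation h g s)"
  using assms unfolding pos_cont_def log_variation_def
  by (auto intro!: continuous_intros)

text \<open>An envelope argument: the maximizer of the varied quotient is a competitor for the
  original one. \<open>log_variation_upper\<close> exchanges the roles, so the difference quotient
  is squeezed between the values of g at the new and at the old maximizer.\<close>

lemma log_variation_lower:
  assumes h: "pos_cont h" and g: "continuous_on S g" and x: "x \<in> S" and s: "s > 0"
    and u: "u \<in> S" "polar_gauge (log_variation h g s) x = (u \<bullet> x) / log_variation h g s u"
  shows "g u \<le> (ln (polar_gauge h x) - ln (polar_gauge (log_variation h g s) x)) / s"
proof -
  have f: "pos_cont (log_variation h g s)" by (rule pos_cont_log_variation[OF h g])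
  have hu: "h u > 0" using h u(1) by (simp add: pos_cont_def)
  have ux: "u \<bullet> x > 0" by (rule inner_pos_of_attained[OF f x u])
  have "ln (polar_gauge (log_variation h g s) x) = ln ((u \<bullet> x) / h u) - s * g u"
    using u(2) hu ux by (simp add: log_variation_def ln_div ln_mult)
  moreover have "ln ((u \<bullet> x) / h u) \<le> ln (polar_gauge h x)"
    using polar_gauge_ge[OF h u(1), of x] hu ux by (intro ln_mono) auto
  ultimately have "g u * s \<le> ln (polar_gauge h x) - ln (polar_gauge (log_variation h g s) x)"
    by (simp add: mult.commute)
  then show ?thesis using s by (simp add: pos_le_divide_eq)
qed

lemma log_variation_upper:
  assumes h: "pos_cont h" and g: "continuous_on S g" and x: "x \<in> S" and s: "s > 0"
    and v: "v \<in> S" "polar_gauge h x = (v \<bullet> x) / h v"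
  shows "(ln (polar_gauge h x) - ln (polar_gauge (log_variation h g s) x)) / s \<le> g v"
proof -
  have f: "pos_cont (log_variation h g s)" by (rule pos_cont_log_variation[OF h g])
  have hv: "h v > 0" using h v(1) by (simp add: pos_cont_def)
  have vx: "v \<bullet> x > 0" by (rule inner_pos_of_attained[OF h x v])
  have "ln (polar_gauge h x) - s * g v = ln ((v \<bullet> x) / log_variation h g s v)"
    using v(2) hv vx by (simp add: log_variation_def ln_div ln_mult)
  also have "\<dots> \<le> ln (polar_gauge (log_variation h g s) x)"
    using polar_gauge_ge[OF f v(1), of x] hv vx
    by (intro ln_mono) (auto simp: log_variation_def)
  finally have "ln (polar_gauge h x) - ln (polar_gauge (log_variation h g s) x) \<le> g v * s"
    by (simp add: mult.commute)
  then show ?thesis using s by (simp add: pos_divide_le_eq)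
qed

lemma log_variation_bound:
  assumes h: "pos_cont h" and g: "continuous_on S g" and x: "x \<in> S" and s: "s > 0"
    and B: "\<And>u. u \<in> S \<Longrightarrow> \<bar>g u\<bar> \<le> B"
  shows "\<bar>(ln (polar_gauge h x) - ln (polar_gauge (log_variation h g s) x)) / s\<bar> \<le> B"
proof -
  have f: "pos_cont (log_variation h g s)" by (rule pos_cont_log_variation[OF h g])
  obtain u where u: "u \<in> S" "polar_gauge (log_variation h g s) x = (u \<bullet> x) / log_variation h g s u"
    using polar_gauge_attained[OF f] by metis
  obtain v where v: "v \<in> S" "polar_gauge h x = (v \<bullet> x) / h v"
    using polar_gauge_attained[OF h] by metis
  show ?thesis
    using log_variation_lower[OF h g x s u] log_variation_upper[OF h g x s v] B[OF u(1)] B[OF v(1)]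
    by linarith
qed

lemma continuous_on_log_variation_quotient:
  assumes "pos_cont h" "continuous_on S g" "s > 0"
  shows "continuous_on S (\<lambda>x. (ln (polar_gauge h x) - ln (polar_gauge (log_variation h g s) x)) / s)"
  using assms(3)
  by (intro continuous_on_divide continuous_on_diff continuous_on_const
      continuous_on_ln_polar_gauge pos_cont_log_variation assms(1,2)) auto

lemma inverse_Suc_tendsto_0: "(\<lambda>k. 1 / real (Suc k)) \<longlonglongrightarrow> 0"
  using LIMSEQ_inverse_real_of_nat by (simp add: inverse_eq_divide)

text \<open>The upper estimate holds for every k. For the lower one, the maximizers of the varied
  quotients must eventually avoid the compact set C where g stays at or below a: by uniqueness of v
  the original quotient has a maximum m on C strictly below the global one.\<close>

lemma log_variation_tendsto:
  fixes h g :: "'a::euclidean_space \<Rightarrow> real"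
  assumes h: "pos_cont h" and g: "continuous_on S g" and x: "x \<in> S"
    and v: "v \<in> S" "polar_gauge h x = (v \<bullet> x) / h v"
    and uniq: "\<And>w. w \<in> S \<Longrightarrow> polar_gauge h x = (w \<bullet> x) / h w \<Longrightarrow> w = v"
  shows "(\<lambda>k. (ln (polar_gauge h x) - ln (polar_gauge (log_variation h g (1 / Suc k)) x)) / (1 / Suc k))
    \<longlonglongrightarrow> g v"
proof (rule order_tendstoI)
  let ?q = "\<lambda>k. (ln (polar_gauge h x) - ln (polar_gauge (log_variation h g (1 / Suc k)) x)) / (1 / Suc k)"
  fix a assume "g v < a"
  moreover have "?q k \<le> g v" for k by (rule log_variation_upper[OF h g x _ v]) simp
  ultimately show "\<forall>\<^sub>F k in sequentially. ?q k < a"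
    by (intro always_eventually allI) (meson le_less_trans)
next
  let ?q = "\<lambda>k. (ln (polar_gauge h x) - ln (polar_gauge (log_variation h g (1 / Suc k)) x)) / (1 / Suc k)"
  fix a assume a: "a < g v"
  define C where "C = S \<inter> {u. g u \<le> a}"
  have cC: "compact C"
  proof -
    have "closedin (top_of_set S) (S \<inter> g -` {..a})"
      by (rule continuous_closedin_preimage[OF g]) simp
    moreover have "S \<inter> g -` {..a} = C" by (auto simp: C_def)
    ultimately have "closed C" using closedin_closed_eq[OF closed_sphere] by metis
    then show ?thesis unfolding C_def
      by (metis C_def Int_lower1 bounded_sphere bounded_subset compact_eq_bounded_closed)
  qed
  have high: "?q k > a" if u: "u \<in> S" "polar_gauge (log_variation h g (1 / Suc k)) x = (u \<bullet> x) / log_variation h g (1 / Suc k) u"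
    and n: "u \<notin> C" for k u
    using log_variation_lower[OF h g x _ u] n u(1) by (auto simp: C_def)
  have f: "pos_cont (log_variation h g s)" for s by (rule pos_cont_log_variation[OF h g])
  show "\<forall>\<^sub>F k in sequentially. a < ?q k"
  proof (cases "C = {}")
    case True
    have "?q k > a" for k
    proof -
      obtain u where "u \<in> S" "polar_gauge (log_variation h g (1 / Suc k)) x = (u \<bullet> x) / log_variation h g (1 / Suc k) u"
        using polar_gauge_attained[OF f] by metis
      then show ?thesis using high True by blast
    qed
    then show ?thesis by simp
  next
    case False
    have "continuous_on C (\<lambda>u. (u \<bullet> x) / h u)"
      using h unfolding C_def pos_cont_def
      by (auto intro!: continuous_intros intro: continuous_on_subset)
    then obtain c where c: "c \<in> C" "\<And>u. u \<in> C \<Longrightarrow> (u \<bullet> x) / h u \<le> (c \<bullet> x) / h c"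
      using continuous_attains_sup[OF cC False] by blast
    define m where "m = (c \<bullet> x) / h c"
    have cS: "c \<in> S" "c \<noteq> v" using c(1) a by (auto simp: C_def)
    have "m \<noteq> polar_gauge h x" using uniq[OF cS(1)] cS(2) by (auto simp: m_def)
    then have m: "m < polar_gauge h x"
      using polar_gauge_ge[OF h cS(1), of x] by (simp add: m_def)
    obtain B where B: "B > 0" "\<And>u. u \<in> S \<Longrightarrow> \<bar>g u\<bar> \<le> B"
      using continuous_on_sphere_bounded[OF g] by metis
    \<comment> \<open>Comparing a point of C with v after the variation costs a factor of at most
      exp (2 B s); this tends to 1 and so eventually cannot bridge the gap between m and the
      maximum.\<close>
    have "(\<lambda>k. m * exp (2 * B * (1 / real (Suc k)))) \<longlonglongrightarrow> m * exp (2 * B * 0)"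
      by (intro tendsto_intros inverse_Suc_tendsto_0)
    then have "\<forall>\<^sub>F k in sequentially. m * exp (2 * B * (1 / real (Suc k))) < polar_gauge h x"
      using m by (intro order_tendstoD(2)) auto
    then show ?thesis
    proof (rule eventually_mono)
      fix k
      assume k: "m * exp (2 * B * (1 / real (Suc k))) < polar_gauge h x"
      define s where "s = 1 / real (Suc k)"
      have s: "s > 0" by (simp add: s_def)
      obtain u where u: "u \<in> S" "polar_gauge (log_variation h g s) x = (u \<bullet> x) / log_variation h g s u"
        using polar_gauge_attained[OF f] by metis
      have "u \<notin> C"
      proof
        assume uC: "u \<in> C"
        have hp: "h u > 0" using h u(1) by (auto simp: pos_cont_def)
        have "u \<bullet> x > 0" by (rule inner_pos_of_attained[OF f x u])
        then have ux: "0 < (u \<bullet> x) / h u" "(u \<bullet> x) / h u \<le> m"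
          using hp c(2)[OF uC] by (auto simp: m_def)
        have "polar_gauge h x * exp (- (s * g v)) = (v \<bullet> x) / log_variation h g s v"
          using v(2) by (simp add: log_variation_def exp_minus divide_inverse)
        also have "\<dots> \<le> (u \<bullet> x) / log_variation h g s u"
          using polar_gauge_ge[OF f[of s] v(1), of x] u(2) by simp
        also have "\<dots> = (u \<bullet> x) / h u * exp (- (s * g u))"
          by (simp add: log_variation_def exp_minus divide_inverse)
        also have "\<dots> \<le> m * exp (- (s * g u))"
          using ux by (intro mult_right_mono) auto
        finally have "polar_gauge h x * exp (- (s * g v)) * exp (s * g v) \<le> m * exp (- (s * g u)) * exp (s * g v)"
          by (intro mult_right_mono) auto
        then have "polar_gauge h x \<le> m * exp (s * (g v - g u))"
          by (simp add: mult.assoc flip: exp_add) (simp add: algebra_simps)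
        also have "\<dots> \<le> m * exp (2 * B * s)"
        proof -
          have "g v - g u \<le> 2 * B" using B(2)[OF u(1)] B(2)[OF v(1)] by linarith
          then have "s * (g v - g u) \<le> s * (2 * B)" using s by (intro mult_left_mono) auto
          then show ?thesis using ux by (intro mult_left_mono) (auto simp: mult.commute)
        qed
        finally show False using k by (simp add: s_def)
      qed
      then show "a < ?q k" using high[of u k] u by (simp add: s_def)
    qed
  qed
qed

text \<open>\<open>radial_gauss\<close> makes arbitrary choices at bad directions and need not be measurable there.\<close>
definition gauss_map :: "'a::euclidean_space set \<Rightarrow> 'a \<Rightarrow> 'a" where
  "gauss_map K x = (if x \<in> bad_directions K then (SOME u. u \<in> S) else radial_gauss K x)"

lemma gauss_map_sphere:
  assumes "convex_body_o K" "x \<in> S"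
  shows "gauss_map K x \<in> S"
proof -
  have "\<exists>u::'a. u \<in> S" using sphere_nonempty by blast
  then have "(SOME u::'a. u \<in> S) \<in> S" by (rule someI_ex)
  then show ?thesis using radial_gauss_sphere[OF assms] by (simp add: gauss_map_def)
qed

lemma gauss_map_tendsto:
  assumes K: "convex_body_o K" and g: "continuous_on S g" and x: "x \<in> S" "x \<notin> bad_directions K"
  shows "(\<lambda>k. (ln (polar_gauge (support_fun K) x) - ln (polar_gauge (log_variation (support_fun K) g (1 / Suc k)) x)) / (1 / Suc k))
    \<longlonglongrightarrow> g (gauss_map K x)"
proof -
  have m: "gauss_map K x \<in> radial_gauss_set K x"
    using radial_gauss_mem[OF K x(1)] x(2) by (simp add: gauss_map_def)
  show ?thesis
  proof (rule log_variation_tendsto[OF pos_cont_support_fun[OF K] g x(1)])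
    show "gauss_map K x \<in> S" "polar_gauge (support_fun K) x = gauss_map K x \<bullet> x / support_fun K (gauss_map K x)"
      using m radial_gauss_set_iff[OF K x(1)] by auto
    show "w = gauss_map K x" if "w \<in> S" "polar_gauge (support_fun K) x = w \<bullet> x / support_fun K w" for w
      using that radial_gauss_set_iff[OF K x(1), of w] radial_gauss_set_singleton[OF K x _ m] by auto
  qed
qed

lemma bad_directions_null_sets:
  assumes "convex_body_o K" "class_M lam"
  shows "bad_directions K \<in> null_sets lam"
  using bad_directions_null[OF assms(1)] assms(2)
  by (auto simp: class_M_def absolutely_continuous_def)

text \<open>With g the coordinate function u . i, the difference quotients of the log gauge are
  continuous in x and converge to the i-th coordinate of the normal off the bad directions. The
  first variation formula thus delivers measurability, with no measurable selection
  argument.\<close>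

lemma gauss_map_measurable:
  fixes K :: "'a::euclidean_space set"
  assumes K: "convex_body_o K" and lam: "class_M lam"
  shows "gauss_map K \<in> lam \<rightarrow>\<^sub>M sphere_borel"
proof (rule measurable_restrict_space2)
  have fb: "finite_borel_sphere_measure lam" using lam by (simp add: class_M_def)
  have sp: "space lam = S" using fb by (simp add: finite_borel_sphere_measure_def)
  show "gauss_map K \<in> space lam \<rightarrow> S" using gauss_map_sphere[OF K] sp by auto
  let ?h = "support_fun K"
  have h: "pos_cont ?h" by (rule pos_cont_support_fun[OF K])
  let ?b = "bad_directions K"
  have b: "?b \<in> sets lam" using bad_directions_null_sets[OF K lam] by auto
  show "gauss_map K \<in> borel_measurable lam"
  proof (subst borel_measurable_euclidean_space, rule ballI)
    fix i :: 'a assume "i \<in> Basis"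
    let ?g = "\<lambda>u::'a. u \<bullet> i"
    have g: "continuous_on S ?g" by (intro continuous_intros)
    let ?q = "\<lambda>k x. (ln (polar_gauge ?h x) - ln (polar_gauge (log_variation ?h ?g (1 / Suc k)) x)) / (1 / Suc k)"
    let ?c = "(SOME u::'a. u \<in> S) \<bullet> i"
    have "(\<lambda>x. gauss_map K x \<bullet> i) \<in> borel_measurable lam"
    proof (rule borel_measurable_LIMSEQ_real)
      show "(\<lambda>x. if x \<in> ?b then ?c else ?q k x) \<in> borel_measurable lam" for k
      proof (rule measurable_If_set)
        have "?q k \<in> borel_measurable lam"
          by (rule borel_measurable_continuous_on_sphere[OF fb continuous_on_log_variation_quotient[OF h g]]) simp
        then show "?q k \<in> borel_measurable lam" .
        show "?b \<inter> space lam \<in> sets lam" using b by auto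
      qed simp
      fix x assume "x \<in> space lam"
      then have x: "x \<in> S" using sp by simp
      show "(\<lambda>k. if x \<in> ?b then ?c else ?q k x) \<longlonglongrightarrow> gauss_map K x \<bullet> i"
      proof (cases "x \<in> ?b")
        case True then show ?thesis by (simp add: gauss_map_def)
      next
        case False
        then show ?thesis using gauss_map_tendsto[OF K g x False] by simp
      qed
    qed
    then show "(\<lambda>x. gauss_map K x \<bullet> i) \<in> borel_measurable lam" .
  qed
qed

text \<open>Dominated convergence, with the supremum of |g| as bound. Absolute continuity of
  \<open>lam\<close> enters here, through the nullity of the bad directions. The limit is minus the
  derivative of the energy.\<close>

lemma integral_log_variation_tendsto:
  fixes K :: "'a::euclidean_space set"
  assumes K: "convex_body_o K" and lam: "class_M lam" and g: "continuous_on S g"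
  shows "(\<lambda>k. ((\<integral>x. ln (polar_gauge (support_fun K) x) \<partial>lam)
      - (\<integral>x. ln (polar_gauge (log_variation (support_fun K) g (1 / Suc k)) x) \<partial>lam)) / (1 / Suc k))
    \<longlonglongrightarrow> (\<integral>x. g (gauss_map K x) \<partial>lam)"
proof -
  have fb: "finite_borel_sphere_measure lam" using lam by (simp add: class_M_def)
  then interpret finite_measure lam by (simp add: finite_borel_sphere_measure_def)
  have sp: "space lam = S" using fb by (simp add: finite_borel_sphere_measure_def)
  let ?h = "support_fun K"
  have h: "pos_cont ?h" by (rule pos_cont_support_fun[OF K])
  let ?q = "\<lambda>k x. (ln (polar_gauge ?h x) - ln (polar_gauge (log_variation ?h g (1 / Suc k)) x)) / (1 / Suc k)"
  obtain B where B: "B > 0" "\<And>x. x \<in> S \<Longrightarrow> \<bar>g x\<bar> \<le> B"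
    using continuous_on_sphere_bounded[OF g] by metis
  have c: "continuous_on S (?q k)" for k
    by (rule continuous_on_log_variation_quotient[OF h g]) simp
  have "(\<lambda>k. \<integral>x. ?q k x \<partial>lam) \<longlonglongrightarrow> (\<integral>x. g (gauss_map K x) \<partial>lam)"
  proof (rule integral_dominated_convergence)
    show "?q k \<in> borel_measurable lam" for k
      by (rule borel_measurable_continuous_on_sphere[OF fb c])
    show "integrable lam (\<lambda>_. B)" by simp
    have "g \<in> borel_measurable sphere_borel"
      by (rule borel_measurable_continuous_on_restrict[OF g])
    then show "(\<lambda>x. g (gauss_map K x)) \<in> borel_measurable lam"
      using gauss_map_measurable[OF K lam] by (rule measurable_compose_rev)
    show "AE x in lam. norm (?q k x) \<le> B" for k
    proof (rule AE_I2)
      fix x assume "x \<in> space lam"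
      then show "norm (?q k x) \<le> B"
        using log_variation_bound[OF h g _ _ B(2), of x "1 / Suc k"] sp by (simp del: of_nat_Suc)
    qed
    have "AE x in lam. x \<notin> bad_directions K"
      by (rule AE_not_in[OF bad_directions_null_sets[OF K lam]])
    then show "AE x in lam. (\<lambda>k. ?q k x) \<longlonglongrightarrow> g (gauss_map K x)"
      by (rule AE_mp) (use gauss_map_tendsto[OF K g] sp in \<open>auto intro!: AE_I2\<close>)
  qed
  moreover have "(\<integral>x. ?q k x \<partial>lam) = ((\<integral>x. ln (polar_gauge ?h x) \<partial>lam)
      - (\<integral>x. ln (polar_gauge (log_variation ?h g (1 / Suc k)) x) \<partial>lam)) / (1 / Suc k)" for k
    by (subst Bochner_Integration.integral_diff[symmetric])
       (auto intro!: integrable_continuous_on_sphere[OF fb] continuous_on_ln_polar_gauge h pos_cont_log_variation[OF h g]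
         simp del: of_nat_Suc)
  ultimately show ?thesis by (simp del: of_nat_Suc)
qed

section \<open>Coercivity\<close>

definition psi_cost :: "('a::euclidean_space \<Rightarrow> real \<Rightarrow> real) \<Rightarrow> 'a measure \<Rightarrow> ('a \<Rightarrow> real) \<Rightarrow> real" where
  "psi_cost \<Psi> \<mu> f = (\<integral>u. \<Psi> u (f u) \<partial>\<mu>)"

definition log_energy :: "'a::euclidean_space measure \<Rightarrow> ('a \<Rightarrow> real) \<Rightarrow> real" where
  "log_energy lam f = (\<integral>x. ln (polar_gauge f x) \<partial>lam)"

lemma class_G_I_strict_mono:
  assumes "class_G_I \<Psi>" "u \<in> S" "0 < s" "s < t"
  shows "\<Psi> u s < \<Psi> u t"
proof (rule DERIV_pos_imp_increasing[OF assms(4)])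
  fix x assume "s \<le> x"
  then have "\<Psi> u differentiable (at x)" "deriv (\<Psi> u) x > 0"
    using assms unfolding class_G_I_def by auto
  then show "\<exists>y. DERIV (\<Psi> u) x :> y \<and> y > 0"
    using DERIV_deriv_iff_real_differentiable by blast
qed

lemma class_G_I_mono:
  assumes "class_G_I \<Psi>" "u \<in> S" "0 < s" "s \<le> t"
  shows "\<Psi> u s \<le> \<Psi> u t"
  using class_G_I_strict_mono[OF assms(1,2,3), of t] assms(4) by (cases "s = t") auto

lemma continuous_on_graph:
  fixes F :: "'a::euclidean_space \<Rightarrow> real \<Rightarrow> real"
  assumes "continuous_on (S \<times> {0<..}) (\<lambda>(u,t). F u t)" "pos_cont f"
  shows "continuous_on S (\<lambda>u. F u (f u))"
proof -
  have "continuous_on S (\<lambda>u. (u, f u))"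
    using assms(2) by (auto simp: pos_cont_def intro!: continuous_intros)
  then have "continuous_on S (\<lambda>u. (\<lambda>(u,t). F u t) (u, f u))"
    using assms(2) by (intro continuous_on_compose2[OF assms(1)]) (auto simp: pos_cont_def)
  then show ?thesis by simp
qed

lemma continuous_on_psi:
  assumes "class_G_I \<Psi>" "pos_cont f"
  shows "continuous_on S (\<lambda>u. \<Psi> u (f u))" "continuous_on S (\<lambda>u. deriv (\<Psi> u) (f u))"
  using assms(1) continuous_on_graph[OF _ assms(2), of \<Psi>] continuous_on_graph[OF _ assms(2), of "\<lambda>u. deriv (\<Psi> u)"]
  unfolding class_G_I_def by blast+

lemma psi_cost_mono:
  assumes G: "class_G_I \<Psi>" and fb: "finite_borel_sphere_measure \<mu>"
    and f: "pos_cont f" and g: "pos_cont g" and le: "\<And>u. u \<in> S \<Longrightarrow> f u \<le> g u"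
  shows "psi_cost \<Psi> \<mu> f \<le> psi_cost \<Psi> \<mu> g"
  unfolding psi_cost_def
proof (rule integral_mono)
  show "integrable \<mu> (\<lambda>u. \<Psi> u (f u))" "integrable \<mu> (\<lambda>u. \<Psi> u (g u))"
    by (intro integrable_continuous_on_sphere[OF fb] continuous_on_psi(1)[OF G] f g)+
  fix u assume "u \<in> space \<mu>"
  then have "u \<in> S" using fb by (simp add: finite_borel_sphere_measure_def)
  then show "\<Psi> u (f u) \<le> \<Psi> u (g u)"
    using class_G_I_mono[OF G] f le by (simp add: pos_cont_def)
qed

text \<open>Divergence of \<Psi> u is assumed for each u separately. Monotonicity in t and
  compactness of the sphere make it uniform, as in Dini's theorem: a sequence of violating
  directions would accumulate at some l along which \<Psi> l stays bounded.\<close>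

lemma class_G_I_large:
  assumes G: "class_G_I \<Psi>"
  obtains T where "T > 0" "\<And>u. u \<in> S \<Longrightarrow> \<Psi> u T > M"
proof -
  have "\<exists>n::nat. \<forall>u\<in>S. \<Psi> u (real (Suc n)) > M"
  proof (rule ccontr)
    assume "\<not> ?thesis"
    then have "\<forall>n::nat. \<exists>u\<in>S. \<Psi> u (real (Suc n)) \<le> M" by (simp only: not_ex not_all Ball_def Bex_def not_imp not_less) blast
    then obtain w where w: "\<And>n. w n \<in> S" "\<And>n. \<Psi> (w n) (real (Suc n)) \<le> M" by metis
    obtain l r where l: "l \<in> S" "strict_mono (r :: nat \<Rightarrow> nat)" "(w \<circ> r) \<longlonglongrightarrow> l"
      using compact_sphere[of 0 1] w(1) unfolding compact_def by metis
    have "\<Psi> l (real (Suc n)) \<le> M" for n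
    proof -
      have pc: "pos_cont (\<lambda>_::'a. real (Suc n))" by (simp add: pos_cont_def)
      have "continuous_on S (\<lambda>u. \<Psi> u (real (Suc n)))"
        by (rule continuous_on_psi(1)[OF G pc])
      then have "(\<lambda>k. \<Psi> (w (r k)) (real (Suc n))) \<longlonglongrightarrow> \<Psi> l (real (Suc n))"
        using l(1,3) w(1) unfolding continuous_on_sequentially by (auto simp: o_def)
      moreover have "\<forall>\<^sub>F k in sequentially. \<Psi> (w (r k)) (real (Suc n)) \<le> M"
        unfolding eventually_sequentially
      proof (intro exI allI impI)
        fix k assume "n \<le> k"
        then have "n \<le> r k" using seq_suble[OF l(2), of k] by linarith
        then have "\<Psi> (w (r k)) (real (Suc n)) \<le> \<Psi> (w (r k)) (real (Suc (r k)))"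
          by (intro class_G_I_mono[OF G w(1)]) auto
        then show "\<Psi> (w (r k)) (real (Suc n)) \<le> M" using w(2)[of "r k"] by linarith
      qed
      ultimately show ?thesis by (intro tendsto_upperbound) auto
    qed
    note up = this
    have "filterlim (\<Psi> l) at_top at_top" using G l(1) by (simp add: class_G_I_def)
    then have "\<forall>\<^sub>F t in at_top. \<Psi> l t > M" by (simp add: filterlim_at_top_dense)
    then obtain t0 where t0: "\<And>t. t \<ge> t0 \<Longrightarrow> \<Psi> l t > M" by (auto simp: eventually_at_top_linorder)
    obtain n where "real n \<ge> t0" using real_arch_simple by blast
    then have "\<Psi> l (real (Suc n)) > M" by (intro t0) simp
    then show False using up[of n] by linarith
  qed
  then obtain n where "\<forall>u\<in>S. \<Psi> u (real (Suc n)) > M" by blast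
  then show thesis by (intro that[of "real (Suc n)"]) auto
qed

text \<open>The integral of the positive part of v . u is Lipschitz in v, so compactness turns
  positivity for each v into a positive minimum, which leaves a fixed mass in every cap.\<close>

lemma hemisphere_mass:
  fixes \<mu> :: "'a::euclidean_space measure"
  assumes fb: "finite_borel_sphere_measure \<mu>" and nc: "not_concentrated_on_hemisphere \<mu>"
  obtains \<delta> where "\<delta> > 0" "\<And>v. v \<in> S \<Longrightarrow> measure \<mu> {u\<in>S. v \<bullet> u > \<delta>} \<ge> \<delta>"
proof -
  interpret finite_measure \<mu> using fb by (simp add: finite_borel_sphere_measure_def)
  have sp: "space \<mu> = S" using fb by (simp add: finite_borel_sphere_measure_def)
  define I where "I = (\<lambda>v. \<integral>u. max 0 (v \<bullet> u) \<partial>\<mu>)"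
  have int: "integrable \<mu> (\<lambda>u. max 0 (v \<bullet> u))" for v
    by (intro integrable_continuous_on_sphere[OF fb] continuous_intros)
  have "(measure \<mu> S)-lipschitz_on S I"
  proof (rule lipschitz_onI)
    fix v w :: 'a
    have "I v - I w = (\<integral>u. max 0 (v \<bullet> u) - max 0 (w \<bullet> u) \<partial>\<mu>)"
      unfolding I_def using int by simp
    also have "\<bar>\<dots>\<bar> \<le> (\<integral>u. \<bar>max 0 (v \<bullet> u) - max 0 (w \<bullet> u)\<bar> \<partial>\<mu>)"
      by (rule integral_abs_bound)
    also have "\<dots> \<le> (\<integral>u. norm (v - w) \<partial>\<mu>)"
    proof (rule integral_mono)
      show "integrable \<mu> (\<lambda>u. \<bar>max 0 (v \<bullet> u) - max 0 (w \<bullet> u)\<bar>)" using int by auto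
      fix u assume "u \<in> space \<mu>"
      then have "norm u = 1" using sp by simp
      then have "\<bar>(v - w) \<bullet> u\<bar> \<le> norm (v - w)" using Cauchy_Schwarz_ineq2[of "v - w" u] by simp
      then show "\<bar>max 0 (v \<bullet> u) - max 0 (w \<bullet> u)\<bar> \<le> norm (v - w)"
        by (auto simp: inner_diff_left max_def abs_if split: if_splits)
    qed simp
    also have "\<dots> = measure \<mu> S * dist v w" by (simp add: sp dist_norm)
    finally show "dist (I v) (I w) \<le> measure \<mu> S * dist v w" by (simp add: dist_real_def)
  qed simp
  then have "continuous_on S I" by (rule lipschitz_on_continuous_on)
  then obtain v0 where v0: "v0 \<in> S" "\<And>v. v \<in> S \<Longrightarrow> I v0 \<le> I v"
    using continuous_attains_inf[OF compact_sphere sphere_nonempty] by blast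
  have m: "I v0 > 0" using nc v0(1) by (simp add: not_concentrated_on_hemisphere_def I_def)
  \<comment> \<open>On the sphere the positive part is at most \<delta> plus the indicator of the
    cap. Integrating gives \<delta> times the total mass plus the cap mass, so this \<delta> leaves
    the cap a mass of at least \<delta>.\<close>
  define \<delta> where "\<delta> = I v0 / (1 + measure \<mu> S)"
  have mS: "measure \<mu> S \<ge> 0" by simp
  then have \<delta>: "\<delta> > 0" "\<delta> * (1 + measure \<mu> S) = I v0"
    using m by (auto simp: \<delta>_def add_pos_nonneg add_nonneg_eq_0_iff)
  have "measure \<mu> {u\<in>S. v \<bullet> u > \<delta>} \<ge> \<delta>" if v: "v \<in> S" for v
  proof -
    let ?A = "{u\<in>S. v \<bullet> u > \<delta>}"
    have A: "?A \<in> sets \<mu>" by (rule sets_open_cap[OF fb])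
    have iA: "integrable \<mu> (\<lambda>u. \<delta> + indicator ?A u)"
      using A by (intro Bochner_Integration.integrable_add integrable_real_indicator) (auto simp: emeasure_eq_measure)
    have "\<delta> * (1 + measure \<mu> S) \<le> I v" using v0(2)[OF v] \<delta> by simp
    also have "I v \<le> (\<integral>u. \<delta> + indicator ?A u \<partial>\<mu>)"
      unfolding I_def
    proof (rule integral_mono[OF int iA])
      fix u assume "u \<in> space \<mu>"
      then have "norm u = 1" "u \<in> S" using sp by simp_all
      then have "v \<bullet> u \<le> 1" using norm_cauchy_schwarz[of v u] v by simp
      then show "max 0 (v \<bullet> u) \<le> \<delta> + indicator ?A u"
        using \<delta>(1) \<open>u \<in> S\<close> by (auto simp: indicator_def)
    qed
    also have "\<dots> = \<delta> * measure \<mu> S + measure \<mu> ?A"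
    proof -
      have "integrable \<mu> (\<lambda>u. indicator ?A u :: real)"
        using A by (intro integrable_real_indicator) (auto simp: emeasure_eq_measure)
      moreover have "?A \<inter> space \<mu> = ?A" by (rule sets.Int_space_eq2[OF A])
      ultimately show ?thesis using A by (simp add: sp mult.commute)
    qed
    finally show ?thesis by (simp add: algebra_simps)
  qed
  then show thesis using that \<delta>(1) by blast
qed

text \<open>A far point x of the Wulff shape forces f u to be at least u . x, hence large, on a
  whole cap around its direction, and that cap alone makes the cost exceed c. Only the Wulff shape
  is bounded this way, not f itself.\<close>

lemma wulff_bounded_of_psi_cost:
  fixes \<mu> :: "'a::euclidean_space measure"
  assumes G: "class_G_I \<Psi>" and fb: "finite_borel_sphere_measure \<mu>"
    and nc: "not_concentrated_on_hemisphere \<mu>"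
  obtains R where "R > 0" "\<And>f x. pos_cont f \<Longrightarrow> psi_cost \<Psi> \<mu> f \<le> c \<Longrightarrow> x \<in> wulff f \<Longrightarrow> norm x \<le> R"
proof -
  interpret finite_measure \<mu> using fb by (simp add: finite_borel_sphere_measure_def)
  have sp: "space \<mu> = S" using fb by (simp add: finite_borel_sphere_measure_def)
  obtain \<delta> where \<delta>: "\<delta> > 0" "\<And>v. v \<in> S \<Longrightarrow> measure \<mu> {u\<in>S. v \<bullet> u > \<delta>} \<ge> \<delta>"
    using hemisphere_mass[OF fb nc] by metis
  \<comment> \<open>A value above M on a cap of mass at least \<delta> costs at least M \<delta> =
    |c| + 1, which exceeds c. T is the height at which \<Psi> passes M in all directions, and the
    resulting radius is T / \<delta>.\<close>
  define M where "M = (\<bar>c\<bar> + 1) / \<delta>"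
  have M: "M > 0" "M * \<delta> = \<bar>c\<bar> + 1" using \<delta>(1) by (auto simp: M_def)
  obtain T where T: "T > 0" "\<And>u. u \<in> S \<Longrightarrow> \<Psi> u T > M" using class_G_I_large[OF G] by metis
  show thesis
  proof (rule that)
    show "T / \<delta> > 0" using T \<delta> by simp
    fix f :: "'a \<Rightarrow> real" and x
    assume f: "pos_cont f" and c: "psi_cost \<Psi> \<mu> f \<le> c" and x: "x \<in> wulff f"
    show "norm x \<le> T / \<delta>"
    proof (rule ccontr)
      assume "\<not> norm x \<le> T / \<delta>"
      then have nx: "norm x * \<delta> > T" using \<delta>(1) by (simp add: field_simps)
      then have x0: "norm x > 0" using T(1) by (cases "x = 0") auto
      define v where "v = x /\<^sub>R norm x"
      have v: "v \<in> S" using x0 by (simp add: v_def)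
      let ?A = "{u\<in>S. v \<bullet> u > \<delta>}"
      have A: "?A \<in> sets \<mu>" by (rule sets_open_cap[OF fb])
      have iA: "integrable \<mu> (\<lambda>u. M * indicator ?A u)"
        using A by (intro integrable_mult_right integrable_real_indicator) (auto simp: emeasure_eq_measure)
      have "\<bar>c\<bar> + 1 = M * \<delta>" using M by simp
      also have "\<dots> \<le> M * measure \<mu> ?A" using \<delta>(2)[OF v] M by (intro mult_left_mono) auto
      also have "\<dots> = (\<integral>u. M * indicator ?A u \<partial>\<mu>)"
      proof -
        have "?A \<inter> space \<mu> = ?A" by (rule sets.Int_space_eq2[OF A])
        then show ?thesis using A by simp
      qed
      also have "\<dots> \<le> psi_cost \<Psi> \<mu> f"
        unfolding psi_cost_def
      proof (rule integral_mono[OF iA])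
        show "integrable \<mu> (\<lambda>u. \<Psi> u (f u))"
          by (intro integrable_continuous_on_sphere[OF fb] continuous_on_psi(1)[OF G f])
        fix u assume "u \<in> space \<mu>"
        then have u: "u \<in> S" using sp by simp
        show "M * indicator ?A u \<le> \<Psi> u (f u)"
        proof (cases "u \<in> ?A")
          case True
          then have "norm x * \<delta> \<le> norm x * (v \<bullet> u)" using x0 by (intro mult_left_mono) auto
          also have "\<dots> = u \<bullet> x" using x0 by (simp add: v_def inner_commute)
          also have "\<dots> \<le> f u" using x u by (auto simp: wulff_def)
          finally have "T \<le> f u" using nx by simp
          then have "\<Psi> u T \<le> \<Psi> u (f u)" by (rule class_G_I_mono[OF G u T(1)])
          then show ?thesis using T(2)[OF u] True by simp
        next
          case False
          have "\<Psi> u (f u) > 0" using G f u by (simp add: class_G_I_def pos_cont_def)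
          then show ?thesis using False by simp
        qed
      qed
      finally show False using c by linarith
    qed
  qed
qed

lemma log_energy_mono:
  assumes fb: "finite_borel_sphere_measure lam" and f: "pos_cont f"
    and le: "\<And>x. x \<in> S \<Longrightarrow> g x \<le> ln (polar_gauge f x)" and g: "integrable lam g"
  shows "(\<integral>x. g x \<partial>lam) \<le> log_energy lam f"
  unfolding log_energy_def
proof (rule integral_mono[OF g])
  show "integrable lam (\<lambda>x. ln (polar_gauge f x))"
    by (rule integrable_continuous_on_sphere[OF fb continuous_on_ln_polar_gauge[OF f]])
qed (use le fb in \<open>auto simp: finite_borel_sphere_measure_def\<close>)

lemma ln_polar_gauge_ge:
  assumes "pos_cont f" "R > 0" "\<And>u. u \<in> S \<Longrightarrow> f u \<le> R" "x \<in> S"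
  shows "- ln R \<le> ln (polar_gauge f x)"
proof -
  have "1 / R \<le> polar_gauge f x" using polar_gauge_ge_norm[OF assms(1,3), of x] assms(4) by simp
  then have "ln (1 / R) \<le> ln (polar_gauge f x)" using assms(2) by (intro ln_mono) auto
  then show ?thesis using assms(2) by (simp add: ln_div)
qed

lemma log_energy_ge:
  assumes fb: "finite_borel_sphere_measure lam" and f: "pos_cont f" and R: "R > 0" "\<And>u. u \<in> S \<Longrightarrow> f u \<le> R"
  shows "- ln R * measure lam S \<le> log_energy lam f"
proof -
  interpret finite_measure lam using fb by (simp add: finite_borel_sphere_measure_def)
  have sp: "space lam = S" using fb by (simp add: finite_borel_sphere_measure_def)
  have "(\<integral>x. - ln R \<partial>lam) \<le> log_energy lam f"
    by (rule log_energy_mono[OF fb f ln_polar_gauge_ge[OF f R]]) auto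
  then show ?thesis by (simp add: sp mult.commute)
qed

text \<open>A small value f v makes the gauge at least \<delta> / f v on a cap around v of mass at
  least \<delta>, while the bound R keeps it at least 1 / R elsewhere. The energy therefore grows at
  least like \<delta> times ln (1 / f v).\<close>

lemma log_energy_coercive:
  fixes lam :: "'a::euclidean_space measure"
  assumes fb: "finite_borel_sphere_measure lam" and nc: "not_concentrated_on_hemisphere lam" and R: "R > 0"
  obtains \<eta> where "\<eta> > 0" "\<And>f (v::'a). pos_cont f \<Longrightarrow> (\<And>u. u \<in> S \<Longrightarrow> f u \<le> R) \<Longrightarrow> log_energy lam f \<le> C \<Longrightarrow> v \<in> S \<Longrightarrow> \<eta> \<le> f v"
proof -
  interpret finite_measure lam using fb by (simp add: finite_borel_sphere_measure_def)
  have sp: "space lam = S" using fb by (simp add: finite_borel_sphere_measure_def)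
  obtain \<delta> where \<delta>: "\<delta> > 0" "\<And>v. v \<in> S \<Longrightarrow> measure lam {u\<in>S. v \<bullet> u > \<delta>} \<ge> \<delta>"
    using hemisphere_mass[OF fb nc] by metis
  \<comment> \<open>L is the largest value of q = ln (\<delta> R / f v) that the energy bound C
    permits. The first entry of the minimum defining \<eta> handles f v at least \<delta> R, where q
    is not positive.\<close>
  define L where "L = (C + ln R * measure lam S) / \<delta>"
  define \<eta> where "\<eta> = min (\<delta> * R) (\<delta> * R * exp (- L))"
  show thesis
  proof (rule that)
    show "\<eta> > 0" using \<delta> R by (simp add: \<eta>_def)
    fix f :: "'a \<Rightarrow> real" and v :: 'a
    assume f: "pos_cont f" and fR: "\<And>u. u \<in> S \<Longrightarrow> f u \<le> R" and C: "log_energy lam f \<le> C" and v: "v \<in> S"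
    have fv: "f v > 0" using f v by (simp add: pos_cont_def)
    show "\<eta> \<le> f v"
    proof (cases "f v \<ge> \<delta> * R")
      case True then show ?thesis by (simp add: \<eta>_def)
    next
      case False
      let ?A = "{u\<in>S. v \<bullet> u > \<delta>}"
      define q where "q = ln (\<delta> * R / f v)"
      have q: "q > 0" using False fv \<delta> R by (simp add: q_def)
      have A: "?A \<in> sets lam" by (rule sets_open_cap[OF fb])
      have i1: "integrable lam (\<lambda>u. q * indicator ?A u)"
        using A by (intro integrable_mult_right integrable_real_indicator) (auto simp: emeasure_eq_measure)
      have "(\<integral>x. - ln R + q * indicator ?A x \<partial>lam) \<le> log_energy lam f"
      proof (rule log_energy_mono[OF fb f])
        show "integrable lam (\<lambda>x. - ln R + q * indicator ?A x)" using i1 by auto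
        fix x :: 'a assume x: "x \<in> S"
        show "- ln R + q * indicator ?A x \<le> ln (polar_gauge f x)"
        proof (cases "x \<in> ?A")
          case True
          have "\<delta> / f v \<le> (v \<bullet> x) / f v" using True fv by (intro divide_right_mono) auto
          also have "\<dots> \<le> polar_gauge f x" by (rule polar_gauge_ge[OF f v])
          finally have "ln (\<delta> / f v) \<le> ln (polar_gauge f x)" using \<delta> fv by (intro ln_mono) auto
          moreover have "- ln R + q = ln (\<delta> / f v)" using \<delta> fv R by (simp add: q_def ln_div ln_mult)
          ultimately show ?thesis using True by simp
        next
          case False
          then show ?thesis using ln_polar_gauge_ge[OF f R fR x] by simp
        qed
      qed
      moreover have "(\<integral>x. - ln R + q * indicator ?A x \<partial>lam) = - ln R * measure lam S + q * measure lam ?A"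
      proof -
        have "?A \<inter> space lam = ?A" by (rule sets.Int_space_eq2[OF A])
        then show ?thesis using A i1 by (simp add: sp mult.commute)
      qed
      moreover have "q * \<delta> \<le> q * measure lam ?A" using \<delta>(2)[OF v] q by (intro mult_left_mono) auto
      ultimately have "q * \<delta> \<le> C + ln R * measure lam S" using C by simp
      then have "q \<le> L" using \<delta>(1) by (simp add: L_def pos_le_divide_eq)
      then have "exp q \<le> exp L" by simp
      then have "\<delta> * R / f v \<le> exp L" using \<delta> R fv by (simp add: q_def)
      then have "\<delta> * R * exp (- L) \<le> f v" using fv by (simp add: exp_minus field_simps)
      then show ?thesis by (simp add: \<eta>_def)
    qed
  qed
qed

section \<open>Existence of a minimizer\<close>

text \<open>The factor c adds ln c to the log gauge at each point. Such multiplicative comparison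
  takes the place of continuity of the energy under uniform convergence.\<close>

lemma log_energy_scale_le:
  assumes fb: "finite_borel_sphere_measure lam" and f: "pos_cont f" and g: "pos_cont g"
    and c: "1 \<le> c" and le: "\<And>u. u \<in> S \<Longrightarrow> f u \<le> c * g u"
  shows "log_energy lam g \<le> log_energy lam f + ln c * measure lam S"
proof -
  interpret finite_measure lam using fb by (simp add: finite_borel_sphere_measure_def)
  have sp: "space lam = S" using fb by (simp add: finite_borel_sphere_measure_def)
  have ig: "integrable lam (\<lambda>x. ln (polar_gauge g x))"
    by (rule integrable_continuous_on_sphere[OF fb continuous_on_ln_polar_gauge[OF g]])
  have "(\<integral>x. ln (polar_gauge g x) - ln c \<partial>lam) \<le> log_energy lam f"
  proof (rule log_energy_mono[OF fb f])
    show "integrable lam (\<lambda>x. ln (polar_gauge g x) - ln c)" using ig by simp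
    fix x :: 'a assume x: "x \<in> S"
    have "polar_gauge g x \<le> c * polar_gauge f x"
      using polar_gauge_antimono[OF f g _ le x] c by simp
    then have "ln (polar_gauge g x) \<le> ln (c * polar_gauge f x)"
      using polar_gauge_pos_sphere[OF g x] by (intro ln_mono) auto
    then show "ln (polar_gauge g x) - ln c \<le> ln (polar_gauge f x)"
      using polar_gauge_pos_sphere[OF f x] c by (simp add: ln_mult)
  qed
  moreover have "(\<integral>x. ln (polar_gauge g x) - ln c \<partial>lam) = log_energy lam g - ln c * measure lam S"
    using ig by (simp add: log_energy_def sp mult.commute)
  ultimately show ?thesis by simp
qed

lemma log_energy_support_fun_wulff:
  assumes "finite_borel_sphere_measure lam" "pos_cont f"
  shows "log_energy lam (support_fun (wulff f)) = log_energy lam f"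
  unfolding log_energy_def
  using assms polar_gauge_support_fun_wulff[OF assms(2)]
  by (intro Bochner_Integration.integral_cong) (auto simp: finite_borel_sphere_measure_def)

text \<open>Uniform convergence yields only that g / (1 + \<epsilon>) lies below members of the
  sequence, so the bound for g is reached by letting the scaling tend to 1. Monotonicity of \<Psi>
  makes \<Psi> u (g u) a dominating function.\<close>

lemma psi_cost_closed_under_scaling:
  fixes \<Psi> :: "'a::euclidean_space \<Rightarrow> real \<Rightarrow> real"
  assumes G: "class_G_I \<Psi>" and fb: "finite_borel_sphere_measure \<mu>" and g: "pos_cont g"
    and le: "\<And>\<epsilon>. \<epsilon> > 0 \<Longrightarrow> psi_cost \<Psi> \<mu> (\<lambda>u. g u / (1 + \<epsilon>)) \<le> c"
  shows "psi_cost \<Psi> \<mu> g \<le> c"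
proof -
  have sp: "space \<mu> = S" using fb by (simp add: finite_borel_sphere_measure_def)
  have gk: "pos_cont (\<lambda>u. g u / (1 + \<epsilon>))" if "\<epsilon> > 0" for \<epsilon>
    using g that by (auto simp: pos_cont_def intro!: continuous_intros)
  let ?G = "\<lambda>k u. \<Psi> u (g u / (1 + 1 / real (Suc k)))"
  have "(\<lambda>k. psi_cost \<Psi> \<mu> (\<lambda>u. g u / (1 + 1 / real (Suc k)))) \<longlonglongrightarrow> psi_cost \<Psi> \<mu> g"
    unfolding psi_cost_def
  proof (rule integral_dominated_convergence)
    show "(\<lambda>u. \<Psi> u (g u)) \<in> borel_measurable \<mu>"
      by (rule borel_measurable_continuous_on_sphere[OF fb continuous_on_psi(1)[OF G g]])
    show "?G k \<in> borel_measurable \<mu>" for k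
      by (rule borel_measurable_continuous_on_sphere[OF fb continuous_on_psi(1)[OF G gk]]) simp
    show "integrable \<mu> (\<lambda>u. \<Psi> u (g u))"
      by (rule integrable_continuous_on_sphere[OF fb continuous_on_psi(1)[OF G g]])
    show "AE u in \<mu>. norm (?G k u) \<le> \<Psi> u (g u)" for k
    proof (rule AE_I2)
      fix u assume "u \<in> space \<mu>"
      then have u: "u \<in> S" using sp by simp
      have gu: "g u > 0" using g u by (simp add: pos_cont_def)
      have p: "0 < g u / (1 + 1 / real (Suc k))" using gu by (intro divide_pos_pos add_pos_nonneg) auto
      have "1 \<le> 1 + 1 / real (Suc k)" by simp
      then have "g u / (1 + 1 / real (Suc k)) \<le> g u / 1" using gu by (intro frac_le) auto
      then have "?G k u \<le> \<Psi> u (g u)" using class_G_I_mono[OF G u p] by simp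
      moreover have "?G k u > 0" using G u p by (simp add: class_G_I_def)
      ultimately show "norm (?G k u) \<le> \<Psi> u (g u)" by simp
    qed
    show "AE u in \<mu>. (\<lambda>k. ?G k u) \<longlonglongrightarrow> \<Psi> u (g u)"
    proof (rule AE_I2)
      fix u assume "u \<in> space \<mu>"
      then have u: "u \<in> S" using sp by simp
      have "\<Psi> u differentiable (at (g u))" using G u g by (simp add: class_G_I_def pos_cont_def)
      then have "isCont (\<Psi> u) (g u)" by (rule differentiable_imp_continuous_within)
      moreover have "(\<lambda>k. g u / (1 + 1 / real (Suc k))) \<longlonglongrightarrow> g u / (1 + 0)"
        by (intro tendsto_intros inverse_Suc_tendsto_0) simp
      ultimately show "(\<lambda>k. ?G k u) \<longlonglongrightarrow> \<Psi> u (g u)"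
        by (intro isCont_tendsto_compose[where g = "\<Psi> u"]) simp_all
    qed
  qed
  then show ?thesis
    by (rule LIMSEQ_le_const2) (use le in auto)
qed

lemma log_energy_minimizer_function:
  fixes \<Psi> :: "'a::euclidean_space \<Rightarrow> real \<Rightarrow> real"
  assumes G: "class_G_I \<Psi>" and lam: "finite_borel_sphere_measure lam" and mu: "finite_borel_sphere_measure \<mu>"
    and nl: "not_concentrated_on_hemisphere lam" and nm: "not_concentrated_on_hemisphere \<mu>"
  obtains c g where "pos_cont g" "psi_cost \<Psi> \<mu> g \<le> c"
    "\<And>f. pos_cont f \<Longrightarrow> psi_cost \<Psi> \<mu> f \<le> c \<Longrightarrow> log_energy lam g \<le> log_energy lam f"
proof -
  \<comment> \<open>This level admits the constant function 1, so the constraint set is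
    nonempty.\<close>
  define c where "c = psi_cost \<Psi> \<mu> (\<lambda>_. 1)"
  obtain R where R: "R > 0" "\<And>f x. pos_cont f \<Longrightarrow> psi_cost \<Psi> \<mu> f \<le> c \<Longrightarrow> x \<in> wulff f \<Longrightarrow> norm x \<le> R"
    using wulff_bounded_of_psi_cost[OF G mu nm] by metis
  have hR: "support_fun (wulff f) u \<le> R" if f: "pos_cont f" "psi_cost \<Psi> \<mu> f \<le> c" and u: "u \<in> S" for f u
  proof -
    obtain y where y: "y \<in> wulff f" "support_fun (wulff f) u = u \<bullet> y"
      using support_fun_attained convex_body_nonempty[OF convex_body_wulff[OF f(1)]] by metis
    have "u \<bullet> y \<le> norm y" using norm_cauchy_schwarz[of u y] u by simp
    then show ?thesis using y R(2)[OF f y(1)] by simp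
  qed
  have hp: "pos_cont (support_fun (wulff f))" if "pos_cont f" for f :: "'a \<Rightarrow> real"
    by (rule pos_cont_support_fun[OF convex_body_wulff[OF that]])
  define X where "X = log_energy lam ` {f. pos_cont f \<and> psi_cost \<Psi> \<mu> f \<le> c}"
  have X1: "X \<noteq> {}"
  proof -
    have "pos_cont (\<lambda>_::'a. 1)" by (simp add: pos_cont_def)
    then show ?thesis by (auto simp: X_def c_def)
  qed
  have X2: "bdd_below X"
  proof (rule bdd_belowI)
    fix e assume "e \<in> X"
    then obtain f where f: "pos_cont f" "psi_cost \<Psi> \<mu> f \<le> c" "e = log_energy lam f" by (auto simp: X_def)
    show "- ln R * measure lam S \<le> e"
      using log_energy_ge[OF lam hp[OF f(1)] R(1) hR[OF f(1,2)]] f(3)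
        log_energy_support_fun_wulff[OF lam f(1)] by simp
  qed
  define I0 where "I0 = Inf X"
  have "\<exists>f. pos_cont f \<and> psi_cost \<Psi> \<mu> f \<le> c \<and> log_energy lam f < I0 + 1 / real (Suc n)" for n
  proof -
    have "\<exists>e\<in>X. e < I0 + 1 / real (Suc n)"
      using cInf_lessD[OF X1, of "I0 + 1 / real (Suc n)"] by (auto simp: I0_def)
    then show ?thesis by (auto simp: X_def)
  qed
  then obtain F where F: "\<And>n. pos_cont (F n)" "\<And>n. psi_cost \<Psi> \<mu> (F n) \<le> c"
    "\<And>n. log_energy lam (F n) < I0 + 1 / real (Suc n)" by metis
  \<comment> \<open>The replacement keeps the energy, lies below \<open>F n\<close>, and is bounded
    by R and R-Lipschitz, which \<open>F n\<close> itself need not be.\<close>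
  define h where "h = (\<lambda>n. support_fun (wulff (F n)))"
  have h: "pos_cont (h n)" "log_energy lam (h n) = log_energy lam (F n)"
    "\<And>u. u \<in> S \<Longrightarrow> h n u \<le> R" "\<And>u. u \<in> S \<Longrightarrow> h n u \<le> F n u" for n
    using hp[OF F(1)] log_energy_support_fun_wulff[OF lam F(1)] hR[OF F(1,2)] support_fun_wulff_le[OF F(1)]
    by (simp_all add: h_def)
  \<comment> \<open>The level I0 + 1 covers the whole sequence, because 1 / Suc n is at most 1
    already for n = 0; hence one lower bound serves all n.\<close>
  obtain \<eta> where \<eta>: "\<eta> > 0" "\<And>f (v::'a). pos_cont f \<Longrightarrow> (\<And>u. u \<in> S \<Longrightarrow> f u \<le> R) \<Longrightarrow> log_energy lam f \<le> I0 + 1 \<Longrightarrow> v \<in> S \<Longrightarrow> \<eta> \<le> f v"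
    using log_energy_coercive[OF lam nl R(1)] by metis
  have h\<eta>: "\<eta> \<le> h n v" if "v \<in> S" for n v
  proof (rule \<eta>(2)[OF h(1,3) _ that])
    have "1 / real (Suc n) \<le> 1" by simp
    then show "log_energy lam (h n) \<le> I0 + 1" using F(3)[of n] h(2)[of n] by linarith
  qed
  obtain g k where g: "continuous_on S g" and k: "strict_mono (k :: nat \<Rightarrow> nat)"
    and gk: "\<And>e. 0 < e \<Longrightarrow> \<exists>N. \<forall>n x. n \<ge> N \<and> x \<in> S \<longrightarrow> norm (h (k n) x - g x) < e"
  proof (rule Arzela_Ascoli[of S h R])
    show "norm (h n x) \<le> R" if "x \<in> S" for n x
      using h\<eta>[OF that, of n] \<eta>(1) h(3)[OF that, of n] by simp
    show "\<exists>d>0. \<forall>n y. y \<in> S \<and> norm (x - y) < d \<longrightarrow> norm (h n x - h n y) < e"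
      if "x \<in> S" "0 < e" for x e
    proof (intro exI conjI allI impI)
      show "e / R > 0" using that R by simp
      fix n y assume y: "y \<in> S \<and> norm (x - y) < e / R"
      have "\<bar>h n x - h n y\<bar> \<le> R * norm (x - y)"
        unfolding h_def
        by (rule support_fun_lipschitz[OF convex_body_wulff[OF F(1)] R(2)[OF F(1,2)]])
      also have "\<dots> < e" using y R(1) by (simp add: field_simps)
      finally show "norm (h n x - h n y) < e" by simp
    qed
  qed (use that in auto)
  have g\<eta>: "\<eta> \<le> g v" if v: "v \<in> S" for v
  proof (rule field_le_epsilon)
    fix e :: real assume "0 < e"
    then obtain N where "\<forall>n x. n \<ge> N \<and> x \<in> S \<longrightarrow> norm (h (k n) x - g x) < e" using gk by blast
    then have "norm (h (k N) v - g v) < e" using v by blast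
    then show "\<eta> \<le> g v + e" using h\<eta>[OF v, of "k N"] by (simp add: abs_less_iff)
  qed
  have pg: "pos_cont g" using g g\<eta> \<eta>(1) unfolding pos_cont_def by force
  \<comment> \<open>The common lower bound \<eta> turns the additive error \<eta> \<epsilon> into a
    multiplicative one. Both directions are used: g below (1 + \<epsilon>) h n for the cost, and h n
    below (1 + \<epsilon>) g for the energy.\<close>
  have close: "\<exists>n\<ge>m. \<forall>u\<in>S. h n u \<le> (1 + \<epsilon>) * g u \<and> g u \<le> (1 + \<epsilon>) * h n u" if e: "\<epsilon> > 0" for \<epsilon> m
  proof -
    obtain N where N: "\<forall>n x. n \<ge> N \<and> x \<in> S \<longrightarrow> norm (h (k n) x - g x) < \<eta> * \<epsilon>"
      using gk[OF mult_pos_pos[OF \<eta>(1) e]] by blast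
    show ?thesis
    proof (intro exI conjI ballI)
      show "k (max N m) \<ge> m" using seq_suble[OF k, of "max N m"] by simp
      fix u :: 'a assume u: "u \<in> S"
      have "norm (h (k (max N m)) u - g u) < \<eta> * \<epsilon>" using N u by simp
      then have d: "\<bar>h (k (max N m)) u - g u\<bar> < \<eta> * \<epsilon>" by simp
      have "\<eta> * \<epsilon> \<le> g u * \<epsilon>" "\<eta> * \<epsilon> \<le> h (k (max N m)) u * \<epsilon>"
        using g\<eta>[OF u] h\<eta>[OF u] e by (auto intro!: mult_right_mono)
      then show "h (k (max N m)) u \<le> (1 + \<epsilon>) * g u" "g u \<le> (1 + \<epsilon>) * h (k (max N m)) u"
        using d by (simp_all add: algebra_simps abs_less_iff)
    qed
  qed
  have cost: "psi_cost \<Psi> \<mu> g \<le> c"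
  proof (rule psi_cost_closed_under_scaling[OF G mu pg])
    fix \<epsilon> :: real assume e: "\<epsilon> > 0"
    obtain n where n: "\<forall>u\<in>S. h n u \<le> (1 + \<epsilon>) * g u \<and> g u \<le> (1 + \<epsilon>) * h n u"
      using close[OF e] by metis
    have "psi_cost \<Psi> \<mu> (\<lambda>u. g u / (1 + \<epsilon>)) \<le> psi_cost \<Psi> \<mu> (F n)"
    proof (rule psi_cost_mono[OF G mu _ F(1)])
      show "pos_cont (\<lambda>u. g u / (1 + \<epsilon>))"
        using pg e by (auto simp: pos_cont_def intro!: continuous_intros)
      fix u :: 'a assume u: "u \<in> S"
      have "g u / (1 + \<epsilon>) \<le> h n u" using n u e by (simp add: pos_divide_le_eq mult.commute)
      then show "g u / (1 + \<epsilon>) \<le> F n u" using h(4)[OF u, of n] by simp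
    qed
    then show "psi_cost \<Psi> \<mu> (\<lambda>u. g u / (1 + \<epsilon>)) \<le> c" using F(2)[of n] by simp
  qed
  have energy: "log_energy lam g \<le> I0"
  proof (rule field_le_epsilon)
    fix e :: real assume e: "0 < e"
    have mS: "measure lam S \<ge> 0" by simp
    define q where "q = 1 + measure lam S"
    have q: "q > 0" using mS unfolding q_def by linarith
    \<comment> \<open>The scaling error ln (1 + \<epsilon>) times the total mass then takes at most
      half of e; the other half is left for the gap of the minimizing sequence to its
      infimum.\<close>
    define \<epsilon> where "\<epsilon> = e / (2 * q)"
    have \<epsilon>: "\<epsilon> > 0" "\<epsilon> * (1 + measure lam S) = e / 2"
      using e q unfolding q_def[symmetric] by (simp_all add: \<epsilon>_def)
    obtain m where m: "1 / real (Suc m) < e / 2" using nat_approx_posE[of "e / 2"] e by auto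
    obtain n where n: "n \<ge> m" "\<forall>u\<in>S. h n u \<le> (1 + \<epsilon>) * g u \<and> g u \<le> (1 + \<epsilon>) * h n u"
      using close[OF \<epsilon>(1)] by metis
    have 1: "log_energy lam g \<le> log_energy lam (h n) + ln (1 + \<epsilon>) * measure lam S"
      using \<epsilon>(1) n(2) by (intro log_energy_scale_le[OF lam h(1) pg]) auto
    have 2: "ln (1 + \<epsilon>) * measure lam S \<le> \<epsilon> * (1 + measure lam S)"
      using \<epsilon>(1) mS ln_add_one_self_le_self[of \<epsilon>] by (intro mult_mono) auto
    have 3: "log_energy lam (h n) \<le> I0 + 1 / real (Suc n)" using F(3)[of n] h(2)[of n] by simp
    have 4: "1 / real (Suc n) \<le> 1 / real (Suc m)" using n(1) by (intro divide_left_mono) auto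
    show "log_energy lam g \<le> I0 + e" using 1 2 3 4 m \<epsilon>(2) by linarith
  qed
  show thesis
  proof (rule that[OF pg cost])
    fix f assume "pos_cont f" "psi_cost \<Psi> \<mu> f \<le> c"
    then have "I0 \<le> log_energy lam f"
      unfolding I0_def by (intro cInf_lower X2) (auto simp: X_def)
    then show "log_energy lam g \<le> log_energy lam f" using energy by simp
  qed
qed

text \<open>Replacing g by the support function of its Wulff shape keeps the energy and does not
  raise the cost. Taking the body's own cost as the new level can only shrink the set of
  competitors, and any variation that lowers the cost becomes admissible.\<close>

lemma log_energy_minimizer_body:
  fixes \<Psi> :: "'a::euclidean_space \<Rightarrow> real \<Rightarrow> real"
  assumes G: "class_G_I \<Psi>" and lam: "finite_borel_sphere_measure lam" and mu: "finite_borel_sphere_measure \<mu>"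
    and nl: "not_concentrated_on_hemisphere lam" and nm: "not_concentrated_on_hemisphere \<mu>"
  obtains K where "convex_body_o K"
    "\<And>f. pos_cont f \<Longrightarrow> psi_cost \<Psi> \<mu> f \<le> psi_cost \<Psi> \<mu> (support_fun K) \<Longrightarrow>
      log_energy lam (support_fun K) \<le> log_energy lam f"
proof -
  obtain c g where g: "pos_cont g" "psi_cost \<Psi> \<mu> g \<le> c"
    "\<And>f. pos_cont f \<Longrightarrow> psi_cost \<Psi> \<mu> f \<le> c \<Longrightarrow> log_energy lam g \<le> log_energy lam f"
    using log_energy_minimizer_function[OF G lam mu nl nm] by metis
  show thesis
  proof (rule that)
    show b: "convex_body_o (wulff g)" by (rule convex_body_wulff[OF g(1)])
    have le: "psi_cost \<Psi> \<mu> (support_fun (wulff g)) \<le> psi_cost \<Psi> \<mu> g"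
      by (rule psi_cost_mono[OF G mu pos_cont_support_fun[OF b] g(1) support_fun_wulff_le[OF g(1)]])
    fix f assume "pos_cont f" "psi_cost \<Psi> \<mu> f \<le> psi_cost \<Psi> \<mu> (support_fun (wulff g))"
    then show "log_energy lam (support_fun (wulff g)) \<le> log_energy lam f"
      using g(2,3) le log_energy_support_fun_wulff[OF lam g(1)] by simp
  qed
qed

section \<open>The Euler-Lagrange equation\<close>

text \<open>Differentiation under the integral along s = 1 / (k + 1). The derivative in s is
  continuous on the compact product of the sphere and [0,1], which contains all these steps, so the
  mean value theorem gives a constant dominating the difference quotients.\<close>

lemma psi_cost_variation_tendsto:
  fixes \<Psi> :: "'a::euclidean_space \<Rightarrow> real \<Rightarrow> real"
  assumes G: "class_G_I \<Psi>" and fb: "finite_borel_sphere_measure \<mu>"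
    and h: "pos_cont h" and g: "continuous_on S g"
  shows "(\<lambda>k. (psi_cost \<Psi> \<mu> (log_variation h g (1 / Suc k)) - psi_cost \<Psi> \<mu> h) / (1 / Suc k))
    \<longlonglongrightarrow> (\<integral>u. h u * deriv (\<Psi> u) (h u) * g u \<partial>\<mu>)"
proof -
  interpret finite_measure \<mu> using fb by (simp add: finite_borel_sphere_measure_def)
  have sp: "space \<mu> = S" using fb by (simp add: finite_borel_sphere_measure_def)
  have hp: "h u > 0" if "u \<in> S" for u using h that by (simp add: pos_cont_def)
  let ?f = "\<lambda>u z. h u * exp (z * g u)"
  let ?D = "\<lambda>u z. deriv (\<Psi> u) (?f u z) * (?f u z * g u)"
  have der: "((\<lambda>z. \<Psi> u (?f u z)) has_real_derivative ?D u z) (at z)" if u: "u \<in> S" for u z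
  proof -
    have p: "?f u z > 0" using hp[OF u] by simp
    have 1: "(\<Psi> u has_real_derivative deriv (\<Psi> u) (?f u z)) (at (?f u z))"
      using G u p DERIV_deriv_iff_real_differentiable unfolding class_G_I_def by blast
    have 2: "((\<lambda>z. ?f u z) has_real_derivative (?f u z * g u)) (at z)"
      by (auto intro!: derivative_eq_intros)
    show ?thesis by (rule DERIV_chain2[OF 1 2])
  qed
  obtain B where B: "\<And>u z. u \<in> S \<Longrightarrow> z \<in> {0..1} \<Longrightarrow> \<bar>?D u z\<bar> \<le> B"
  proof -
    have c1: "continuous_on (S \<times> {0..1::real}) (\<lambda>p. h (fst p))" "continuous_on (S \<times> {0..1::real}) (\<lambda>p. g (fst p))"
      using h g unfolding pos_cont_def
      by (auto intro!: continuous_on_compose2[of S _ _ fst] continuous_on_fst continuous_on_id)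
    have c2: "continuous_on (S \<times> {0..1}) (\<lambda>p. ?f (fst p) (snd p))"
      by (intro continuous_intros c1)
    have c3: "continuous_on (S \<times> {0<..}) (\<lambda>(u, t). deriv (\<Psi> u) t)" using G by (simp add: class_G_I_def)
    have "continuous_on (S \<times> {0..1}) (\<lambda>p. (\<lambda>(u, t). deriv (\<Psi> u) t) (fst p, ?f (fst p) (snd p)))"
      by (rule continuous_on_compose2[OF c3])
         (use hp in \<open>auto intro!: continuous_on_Pair c2 continuous_on_fst continuous_on_id\<close>)
    then have "continuous_on (S \<times> {0..1}) (\<lambda>p. ?D (fst p) (snd p))"
      by (intro continuous_on_mult c1 c2) simp
    then have "compact ((\<lambda>p. ?D (fst p) (snd p)) ` (S \<times> {0..1}))"
      by (intro compact_continuous_image compact_Times) auto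
    then have "bounded ((\<lambda>p. ?D (fst p) (snd p)) ` (S \<times> {0..1}))" by (rule compact_imp_bounded)
    then obtain b where b: "\<And>p. p \<in> S \<times> {0..1} \<Longrightarrow> norm (?D (fst p) (snd p)) \<le> b"
      unfolding bounded_iff by blast
    show thesis
    proof (rule that)
      fix u :: 'a and z :: real assume "u \<in> S" "z \<in> {0..1}"
      then show "\<bar>?D u z\<bar> \<le> b" using b[of "(u, z)"] by simp
    qed
  qed
  have pv: "pos_cont (log_variation h g s)" for s by (rule pos_cont_log_variation[OF h g])
  let ?Q = "\<lambda>k u. (\<Psi> u (log_variation h g (1 / Suc k) u) - \<Psi> u (h u)) / (1 / Suc k)"
  have ii: "integrable \<mu> (\<lambda>u. \<Psi> u (f u))" if "pos_cont f" for f
    by (rule integrable_continuous_on_sphere[OF fb continuous_on_psi(1)[OF G that]])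
  have "(\<lambda>k. \<integral>u. ?Q k u \<partial>\<mu>) \<longlonglongrightarrow> (\<integral>u. h u * deriv (\<Psi> u) (h u) * g u \<partial>\<mu>)"
  proof (rule integral_dominated_convergence)
    show "(\<lambda>u. h u * deriv (\<Psi> u) (h u) * g u) \<in> borel_measurable \<mu>"
      using h unfolding pos_cont_def
      by (intro borel_measurable_continuous_on_sphere[OF fb] continuous_on_mult continuous_on_psi(2)[OF G h] g) auto
    show "?Q k \<in> borel_measurable \<mu>" for k
      using ii[OF pv] ii[OF h] by (auto dest!: borel_measurable_integrable)
    show "integrable \<mu> (\<lambda>_. B)" by simp
    show "AE u in \<mu>. norm (?Q k u) \<le> B" for k
    proof (rule AE_I2)
      fix u assume "u \<in> space \<mu>"
      then have u: "u \<in> S" using sp by simp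
      define s where "s = 1 / real (Suc k)"
      have s: "0 < s" "s \<le> 1" by (simp_all add: s_def)
      obtain z where z: "0 < z" "z < s" "\<Psi> u (?f u s) - \<Psi> u (?f u 0) = (s - 0) * ?D u z"
        using MVT2[OF s(1), of "\<lambda>z. \<Psi> u (?f u z)" "?D u"] der[OF u] by blast
      have "\<bar>?D u z\<bar> \<le> B" using B[OF u, of z] z s by simp
      moreover have "(\<Psi> u (log_variation h g s u) - \<Psi> u (h u)) / s = ?D u z"
        using z s by (simp add: log_variation_def)
      ultimately show "norm (?Q k u) \<le> B" by (simp add: s_def)
    qed
    show "AE u in \<mu>. (\<lambda>k. ?Q k u) \<longlonglongrightarrow> h u * deriv (\<Psi> u) (h u) * g u"
    proof (rule AE_I2)
      fix u assume "u \<in> space \<mu>"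
      then have u: "u \<in> S" using sp by simp
      have "(\<lambda>s. (\<Psi> u (?f u (0 + s)) - \<Psi> u (?f u 0)) / s) \<midarrow>0\<rightarrow> ?D u 0"
        using der[OF u, of 0] unfolding DERIV_def .
      moreover have "filterlim (\<lambda>k. 1 / real (Suc k)) (at 0) sequentially"
        by (intro filterlim_atI inverse_Suc_tendsto_0) auto
      ultimately have "(\<lambda>k. (\<Psi> u (?f u (0 + 1 / real (Suc k))) - \<Psi> u (?f u 0)) / (1 / real (Suc k))) \<longlonglongrightarrow> ?D u 0"
        by (rule filterlim_compose)
      then show "(\<lambda>k. ?Q k u) \<longlonglongrightarrow> h u * deriv (\<Psi> u) (h u) * g u"
        by (simp add: log_variation_def mult_ac del: of_nat_Suc)
    qed
  qed
  moreover have "(\<integral>u. ?Q k u \<partial>\<mu>) = (psi_cost \<Psi> \<mu> (log_variation h g (1 / Suc k)) - psi_cost \<Psi> \<mu> h) / (1 / Suc k)" for k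
    using ii[OF pv] ii[OF h] by (simp add: psi_cost_def del: of_nat_Suc)
  ultimately show ?thesis by (simp del: of_nat_Suc)
qed

lemma pos_cont_weight:
  assumes "class_G_I \<Psi>" "pos_cont f"
  shows "pos_cont (\<lambda>u. f u * deriv (\<Psi> u) (f u))"
  using assms continuous_on_psi(2)[OF assms] unfolding pos_cont_def class_G_I_def
  by (auto intro!: continuous_on_mult)

text \<open>A multiplier rule from one-sided information: for the linear functionals
  \<open>L1\<close> and \<open>L2\<close>, \<open>L1 g < 0\<close> implies
  \<open>L2 g \<le> 0\<close>. Both are positive on the constant 1, and shifting g by constants
  upgrades the implication to proportionality, with \<kappa> the ratio of \<open>L2\<close> to
  \<open>L1\<close> on that constant.\<close>

lemma proportional_functionals:
  fixes \<Psi> :: "'a::euclidean_space \<Rightarrow> real \<Rightarrow> real"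
  assumes G: "class_G_I \<Psi>" and lam: "class_M lam" and mu: "finite_borel_sphere_measure \<mu>"
    and K: "convex_body_o K"
    and min: "\<And>f. pos_cont f \<Longrightarrow> psi_cost \<Psi> \<mu> f \<le> psi_cost \<Psi> \<mu> (support_fun K) \<Longrightarrow>
      log_energy lam (support_fun K) \<le> log_energy lam f"
  obtains \<kappa> where "\<kappa> > 0"
    "\<And>g :: 'a \<Rightarrow> real. continuous_on S g \<Longrightarrow>
      (\<integral>x. g (gauss_map K x) \<partial>lam) = \<kappa> * (\<integral>u. support_fun K u * deriv (\<Psi> u) (support_fun K u) * g u \<partial>\<mu>)"
proof -
  let ?h = "support_fun K"
  have h: "pos_cont ?h" by (rule pos_cont_support_fun[OF K])
  have fl: "finite_borel_sphere_measure lam" using lam by (simp add: class_M_def)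
  interpret L: finite_measure lam using fl by (simp add: finite_borel_sphere_measure_def)
  have sl: "space lam = S" "emeasure lam S \<noteq> 0" using fl by (simp_all add: finite_borel_sphere_measure_def)
  interpret M: finite_measure \<mu> using mu by (simp add: finite_borel_sphere_measure_def)
  have sm: "space \<mu> = S" "emeasure \<mu> S \<noteq> 0" using mu by (simp_all add: finite_borel_sphere_measure_def)
  define w where "w = (\<lambda>u. ?h u * deriv (\<Psi> u) (?h u))"
  have w: "pos_cont w" unfolding w_def by (rule pos_cont_weight[OF G h])
  define L1 where "L1 = (\<lambda>g. \<integral>u. w u * g u \<partial>\<mu>)"
  define L2 where "L2 = (\<lambda>g :: 'a \<Rightarrow> real. \<integral>x. g (gauss_map K x) \<partial>lam)"
  have i1: "integrable \<mu> (\<lambda>u. w u * g u)" if "continuous_on S g" for g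
    using w that by (intro integrable_continuous_on_sphere[OF mu] continuous_on_mult) (auto simp: pos_cont_def)
  have i2: "integrable lam (\<lambda>x. g (gauss_map K x))" if g: "continuous_on S g" for g :: "'a \<Rightarrow> real"
  proof -
    obtain B where B: "\<And>x. x \<in> S \<Longrightarrow> \<bar>g x\<bar> \<le> B" using continuous_on_sphere_bounded[OF g] by metis
    have "(\<lambda>x. g (gauss_map K x)) \<in> borel_measurable lam"
      using gauss_map_measurable[OF K lam] borel_measurable_continuous_on_restrict[OF g]
      by (rule measurable_compose)
    moreover have "AE x in lam. norm (g (gauss_map K x)) \<le> B"
      using B gauss_map_sphere[OF K] sl by (intro AE_I2) auto
    ultimately show ?thesis by (intro L.integrable_const_bound)
  qed
  \<comment> \<open>\<open>L1\<close> is the derivative of the cost along g, and \<open>L2\<close>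
    is minus the derivative of the energy. A direction that strictly lowers the cost is admissible
    for small steps, so by minimality the energy does not drop along it.\<close>
  have sign: "L2 g \<le> 0" if g: "continuous_on S g" and neg: "L1 g < 0" for g
  proof -
    let ?f = "\<lambda>k. log_variation ?h g (1 / real (Suc k))"
    have "\<forall>\<^sub>F k in sequentially. (psi_cost \<Psi> \<mu> (?f k) - psi_cost \<Psi> \<mu> ?h) / (1 / real (Suc k)) < 0"
      using order_tendstoD(2)[OF psi_cost_variation_tendsto[OF G mu h g]] neg
      unfolding L1_def w_def by blast
    then have "\<forall>\<^sub>F k in sequentially. (log_energy lam ?h - log_energy lam (?f k)) / (1 / real (Suc k)) \<le> 0"
    proof (rule eventually_mono)
      fix k assume "(psi_cost \<Psi> \<mu> (?f k) - psi_cost \<Psi> \<mu> ?h) / (1 / real (Suc k)) < 0"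
      then have "psi_cost \<Psi> \<mu> (?f k) \<le> psi_cost \<Psi> \<mu> ?h"
        by (simp add: mult_less_0_iff del: of_nat_Suc)
      then have "log_energy lam ?h \<le> log_energy lam (?f k)"
        by (rule min[OF pos_cont_log_variation[OF h g]])
      then show "(log_energy lam ?h - log_energy lam (?f k)) / (1 / real (Suc k)) \<le> 0"
        by (simp add: mult_le_0_iff del: of_nat_Suc)
    qed
    moreover have "(\<lambda>k. (log_energy lam ?h - log_energy lam (?f k)) / (1 / real (Suc k))) \<longlonglongrightarrow> L2 g"
      using integral_log_variation_tendsto[OF K lam g] unfolding log_energy_def L2_def .
    ultimately show "L2 g \<le> 0" by (intro tendsto_upperbound) auto
  qed
  define a where "a = (\<integral>u. w u \<partial>\<mu>)"
  define b where "b = measure lam S"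
  have b: "b > 0" using sl L.emeasure_eq_measure by (simp add: b_def zero_less_measure_iff)
  have a: "a > 0"
  proof -
    obtain m where m: "m > 0" "\<And>u. u \<in> S \<Longrightarrow> m \<le> w u" using pos_cont_bounds[OF w] by metis
    have "m * measure \<mu> S = (\<integral>u. m \<partial>\<mu>)" by (simp add: sm mult.commute)
    also have "\<dots> \<le> a" unfolding a_def
      using i1[of "\<lambda>_. 1"] m sm by (intro integral_mono) auto
    finally have "m * measure \<mu> S \<le> a" .
    moreover have "measure \<mu> S > 0" using sm M.emeasure_eq_measure by (simp add: zero_less_measure_iff)
    ultimately show ?thesis using mult_pos_pos[OF m(1), of "measure \<mu> S"] by linarith
  qed
  have upper: "L2 g \<le> b / a * L1 g" if g: "continuous_on S g" for g
  proof (rule field_le_epsilon)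
    fix e :: real assume e: "e > 0"
    \<comment> \<open>Subtracting d makes \<open>L1\<close> equal to - e a / b, strictly negative as
      \<open>sign\<close> requires; the price in \<open>L2\<close> is d b, which exceeds the wanted
      bound by exactly e.\<close>
    define d where "d = L1 g / a + e / b"
    have c: "continuous_on S (\<lambda>u. g u - d)" using g by (intro continuous_intros)
    have "L1 (\<lambda>u. g u - d) = L1 g - d * a"
    proof -
      have "L1 (\<lambda>u. g u - d) = (\<integral>u. w u * g u - d * (w u * 1) \<partial>\<mu>)"
        unfolding L1_def by (simp add: algebra_simps)
      also have "\<dots> = L1 g - d * a"
        using i1[OF g] i1[of "\<lambda>_. 1"] by (simp add: L1_def a_def)
      finally show ?thesis .
    qed
    also have "\<dots> = - (e / b * a)" using a by (simp add: d_def distrib_right)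
    also have "\<dots> < 0" using a b e by simp
    finally have "L2 (\<lambda>u. g u - d) \<le> 0" using sign[OF c] by simp
    moreover have "L2 (\<lambda>u. g u - d) = L2 g - d * b"
      unfolding L2_def using i2[OF g] by (simp add: sl b_def mult.commute)
    moreover have "d * b = b / a * L1 g + e" using b by (simp add: d_def distrib_right)
    ultimately show "L2 g \<le> b / a * L1 g + e" by linarith
  qed
  show thesis
  proof (rule that)
    show "b / a > 0" using a b by simp
    fix g :: "'a \<Rightarrow> real" assume g: "continuous_on S g"
    have "continuous_on S (\<lambda>u. - g u)" using g by (intro continuous_intros)
    then have "L2 (\<lambda>u. - g u) \<le> b / a * L1 (\<lambda>u. - g u)" by (rule upper)
    then have "- L2 g \<le> - (b / a * L1 g)" by (simp add: L1_def L2_def)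
    then have "L2 g = b / a * L1 g" using upper[OF g] by linarith
    then show "(\<integral>x. g (gauss_map K x) \<partial>lam) = b / a * (\<integral>u. ?h u * deriv (\<Psi> u) (?h u) * g u \<partial>\<mu>)"
      by (simp add: L1_def L2_def w_def)
  qed
qed

text \<open>Indicators of nonempty closed sets are pointwise limits of the continuous functions max
  0 (1 - k dist), so the integrals determine the measures of closed sets, and these form an
  intersection-stable generator.\<close>

lemma sphere_measure_eqI:
  fixes M N :: "'a::euclidean_space measure"
  assumes M: "finite_measure M" "sets M = sets sphere_borel" and N: "finite_measure N" "sets N = sets sphere_borel"
    and eq: "\<And>g :: 'a \<Rightarrow> real. continuous_on S g \<Longrightarrow> (\<integral>x. g x \<partial>M) = (\<integral>x. g x \<partial>N)"
  shows "M = N"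
proof -
  interpret M: finite_measure M by (rule M)
  interpret N: finite_measure N by (rule N)
  have cont: "continuous_on UNIV (\<lambda>x. max 0 (1 - real k * infdist x C))" for k and C :: "'a set"
    by (intro continuous_intros)
  have lim: "(\<lambda>k. \<integral>x. max 0 (1 - real k * infdist x C) \<partial>P) \<longlonglongrightarrow> measure P (C \<inter> space P)"
    if P: "finite_measure P" "sets P = sets sphere_borel" and C: "closed C" "C \<noteq> {}" for P and C :: "'a set"
  proof -
    interpret P: finite_measure P by (rule P)
    have mP: "f \<in> borel_measurable P" if "f \<in> borel_measurable borel" for f :: "'a \<Rightarrow> real"
      using measurable_restrict_space1[OF that] measurable_cong_sets[OF P(2) refl] by blast
    have "(\<lambda>k. \<integral>x. max 0 (1 - real k * infdist x C) \<partial>P) \<longlonglongrightarrow> (\<integral>x. indicator C x \<partial>P)"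
    proof (rule integral_dominated_convergence)
      show "(indicator C :: 'a \<Rightarrow> real) \<in> borel_measurable P" using C by (intro mP) simp
      show "(\<lambda>x. max 0 (1 - real k * infdist x C)) \<in> borel_measurable P" for k
        by (intro mP borel_measurable_continuous_onI cont)
      show "integrable P (\<lambda>_. 1::real)" by simp
      show "AE x in P. norm (max 0 (1 - real k * infdist x C)) \<le> 1" for k
        by (intro AE_I2) (simp add: infdist_nonneg)
      show "AE x in P. (\<lambda>k. max 0 (1 - real k * infdist x C)) \<longlonglongrightarrow> indicator C x"
      proof (rule AE_I2)
        fix x
        show "(\<lambda>k. max 0 (1 - real k * infdist x C)) \<longlonglongrightarrow> indicator C x"
        proof (cases "x \<in> C")
          case True then show ?thesis by simp
        next
          case False
          then have d: "infdist x C > 0"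
            using in_closed_iff_infdist_zero[OF C] infdist_nonneg[of x C] by (simp add: less_le)
          obtain n where n: "1 / infdist x C \<le> real n" using real_arch_simple by blast
          have "\<forall>\<^sub>F k in sequentially. max 0 (1 - real k * infdist x C) = indicator C x"
            unfolding eventually_sequentially
          proof (intro exI allI impI)
            fix k assume "n \<le> k"
            then have "1 / infdist x C \<le> real k" using n by linarith
            then have "1 \<le> real k * infdist x C" using d by (simp add: pos_divide_le_eq)
            then show "max 0 (1 - real k * infdist x C) = indicator C x" using False by simp
          qed
          then show ?thesis by (rule tendsto_eventually)
        qed
      qed
    qed
    then show ?thesis by simp
  qed
  have sp: "space M = S" "space N = S"
    using sets_eq_imp_space_eq[OF M(2)] sets_eq_imp_space_eq[OF N(2)] by (simp_all add: space_restrict_space)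
  have closed_eq: "emeasure M (C \<inter> S) = emeasure N (C \<inter> S)" if C: "closed C" for C
  \<comment> \<open>\<open>infdist x {}\<close> is 0 by convention, so for the empty set the
    approximating functions would be constantly 1.\<close>
  proof (cases "C = {}")
    case False
    have "(\<integral>x. max 0 (1 - real k * infdist x C) \<partial>M) = (\<integral>x. max 0 (1 - real k * infdist x C) \<partial>N)" for k
      by (rule eq[OF continuous_on_subset[OF cont]]) simp
    then have "measure M (C \<inter> S) = measure N (C \<inter> S)"
      using LIMSEQ_unique lim[OF M C False] lim[OF N C False] by (simp add: sp)
    then show ?thesis by (simp add: M.emeasure_eq_measure N.emeasure_eq_measure)
  qed simp
  have id: "(\<lambda>x. x) \<in> M \<rightarrow>\<^sub>M borel" "(\<lambda>x. x) \<in> N \<rightarrow>\<^sub>M borel"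
    using measurable_restrict_space1[OF measurable_ident_sets[OF refl], of borel S]
      measurable_cong_sets[OF M(2) refl] measurable_cong_sets[OF N(2) refl] by blast+
  \<comment> \<open>Both measures are pushed forward to the whole space, where the closed sets
    generate the Borel sets; the result is pulled back to subsets of the sphere at the end.\<close>
  have "distr M borel (\<lambda>x. x) = distr N borel (\<lambda>x. x)"
  proof (rule measure_eqI_generator_eq[where E = "Collect closed" and \<Omega> = UNIV and A = "\<lambda>_. UNIV"])
    show "sets (distr M borel (\<lambda>x. x)) = sigma_sets UNIV (Collect closed)"
      "sets (distr N borel (\<lambda>x. x)) = sigma_sets UNIV (Collect closed)"
      by (simp_all add: borel_eq_closed)
    show "emeasure (distr M borel (\<lambda>x. x)) X = emeasure (distr N borel (\<lambda>x. x)) X" if "X \<in> Collect closed" for X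
      using closed_eq[of X] that id by (simp add: emeasure_distr sp borel_closed)
    show "emeasure (distr M borel (\<lambda>x. x)) UNIV \<noteq> \<infinity>"
      using id by (simp add: emeasure_distr)
  qed (auto simp: Int_stable_def)
  then have *: "emeasure (distr M borel (\<lambda>x. x)) A = emeasure (distr N borel (\<lambda>x. x)) A" for A by simp
  show ?thesis
  proof (rule measure_eqI)
    show "sets M = sets N" using M N by simp
    fix A assume "A \<in> sets M"
    then have A: "A \<in> sets borel" "A \<subseteq> S" using M(2) by (auto simp: sets_restrict_space)
    then have "A \<inter> S = A" by auto
    then show "emeasure M A = emeasure N A" using *[of A] A(1) id by (simp add: emeasure_distr sp)
  qed
qed

section \<open>The Gauss image measure\<close>

lemma distr_gauss_map:
  fixes \<Psi> :: "'a::euclidean_space \<Rightarrow> real \<Rightarrow> real"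
  assumes K: "convex_body_o K" and lam: "class_M lam" and mu: "finite_borel_sphere_measure \<mu>"
    and w: "pos_cont w" and k: "\<kappa> > 0"
    and eq: "\<And>g :: 'a \<Rightarrow> real. continuous_on S g \<Longrightarrow>
      (\<integral>x. g (gauss_map K x) \<partial>lam) = \<kappa> * (\<integral>u. w u * g u \<partial>\<mu>)"
  shows "distr lam sphere_borel (gauss_map K) = density \<mu> (\<lambda>u. ennreal (\<kappa> * w u))"
proof (rule sphere_measure_eqI)
  have fl: "finite_borel_sphere_measure lam" using lam by (simp add: class_M_def)
  interpret L: finite_measure lam using fl by (simp add: finite_borel_sphere_measure_def)
  have sm: "space \<mu> = S" "sets \<mu> = sets sphere_borel" using mu by (simp_all add: finite_borel_sphere_measure_def)
  have wc: "continuous_on S w" "\<And>u. u \<in> S \<Longrightarrow> w u > 0" using w by (auto simp: pos_cont_def)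
  have kw: "(\<lambda>u. \<kappa> * w u) \<in> borel_measurable \<mu>"
    using borel_measurable_continuous_on_sphere[OF mu wc(1)] by simp
  have nn: "AE u in \<mu>. 0 \<le> \<kappa> * w u" using wc(2) k sm by (intro AE_I2) (auto intro: less_imp_le)
  show "finite_measure (distr lam sphere_borel (gauss_map K))"
    by (rule L.finite_measure_distr[OF gauss_map_measurable[OF K lam]])
  show "sets (distr lam sphere_borel (gauss_map K)) = sets sphere_borel" by simp
  show "sets (density \<mu> (\<lambda>u. ennreal (\<kappa> * w u))) = sets sphere_borel" using sm by simp
  show "finite_measure (density \<mu> (\<lambda>u. ennreal (\<kappa> * w u)))"
  proof
    have "emeasure (density \<mu> (\<lambda>u. ennreal (\<kappa> * w u))) (space \<mu>)
        = (\<integral>\<^sup>+u. ennreal (\<kappa> * w u) * indicator (space \<mu>) u \<partial>\<mu>)"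
      using kw by (intro emeasure_density) auto
    also have "\<dots> = (\<integral>\<^sup>+u. ennreal (\<kappa> * w u) \<partial>\<mu>)" by (intro nn_integral_cong) simp
    also have "\<dots> = ennreal (\<integral>u. \<kappa> * w u \<partial>\<mu>)"
      using integrable_continuous_on_sphere[OF mu wc(1)] nn by (intro nn_integral_eq_integral) auto
    finally show "emeasure (density \<mu> (\<lambda>u. ennreal (\<kappa> * w u)))
        (space (density \<mu> (\<lambda>u. ennreal (\<kappa> * w u)))) \<noteq> \<infinity>" by simp
  qed
  fix g :: "'a \<Rightarrow> real" assume g: "continuous_on S g"
  have "(\<integral>x. g x \<partial>distr lam sphere_borel (gauss_map K)) = (\<integral>x. g (gauss_map K x) \<partial>lam)"
    by (rule integral_distr[OF gauss_map_measurable[OF K lam] borel_measurable_continuous_on_restrict[OF g]])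
  also have "\<dots> = (\<integral>u. (\<kappa> * w u) * g u \<partial>\<mu>)" by (simp add: eq[OF g] mult.assoc)
  also have "\<dots> = (\<integral>x. g x \<partial>density \<mu> (\<lambda>u. ennreal (\<kappa> * w u)))"
    by (rule integral_real_density[symmetric, OF kw nn borel_measurable_continuous_on_sphere[OF mu g]])
  finally show "(\<integral>x. g x \<partial>distr lam sphere_borel (gauss_map K)) = (\<integral>x. g x \<partial>density \<mu> (\<lambda>u. ennreal (\<kappa> * w u)))" .
qed

text \<open>The integrand of \<open>J_tilde\<close> is the function 1 / w evaluated at the normal.
  Transported along the Gauss map it meets the density \<kappa> w, and only \<kappa> survives;
  normalising by the value on the sphere later cancels \<kappa> as well.\<close>

lemma J_tilde_eq:
  fixes \<Psi> :: "'a::euclidean_space \<Rightarrow> real \<Rightarrow> real"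
  defines "w \<equiv> \<lambda>K u. support_fun K u * deriv (\<Psi> u) (support_fun K u)"
  assumes G: "class_G_I \<Psi>" and K: "convex_body_o K" and lam: "class_M lam" and mu: "finite_borel_sphere_measure \<mu>"
    and k: "\<kappa> > 0"
    and eq: "\<And>g :: 'a \<Rightarrow> real. continuous_on S g \<Longrightarrow>
      (\<integral>x. g (gauss_map K x) \<partial>lam) = \<kappa> * (\<integral>u. w K u * g u \<partial>\<mu>)"
    and \<omega>: "\<omega> \<in> sets \<mu>"
  shows "J_tilde \<Psi> lam K \<omega> = \<kappa> * measure \<mu> \<omega>"
proof -
  interpret M: finite_measure \<mu> using mu by (simp add: finite_borel_sphere_measure_def)
  have sm: "space \<mu> = S" "sets \<mu> = sets sphere_borel" using mu by (simp_all add: finite_borel_sphere_measure_def)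
  have sl: "space lam = S" using lam by (simp add: class_M_def finite_borel_sphere_measure_def)
  have w: "pos_cont (w K)"
    unfolding w_def by (rule pos_cont_weight[OF G pos_cont_support_fun[OF K]])
  let ?F = "\<lambda>u. indicator \<omega> u * ennreal (1 / w K u)"
  have wm: "(\<lambda>u. 1 / w K u) \<in> borel_measurable sphere_borel"
    using w by (intro borel_measurable_continuous_on_restrict continuous_on_divide continuous_on_const)
      (auto simp: pos_cont_def)
  have \<omega>': "\<omega> \<in> sets sphere_borel" using \<omega> sm by simp
  have Fm: "?F \<in> borel_measurable sphere_borel"
    using wm \<omega>' by (intro borel_measurable_times_ennreal borel_measurable_indicator measurable_compose[OF wm measurable_ennreal]) auto
  have Fm': "?F \<in> borel_measurable \<mu>" using Fm measurable_cong_sets[OF sm(2) refl] by blast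
  have km: "(\<lambda>u. ennreal (\<kappa> * w K u)) \<in> borel_measurable \<mu>"
    using borel_measurable_continuous_on_sphere[OF mu, of "w K"] w by (simp add: pos_cont_def)
  have "AE x in lam. x \<notin> bad_directions K"
    by (rule AE_not_in[OF bad_directions_null_sets[OF K lam]])
  then have "AE x in lam. indicator (reverse_radial_gauss K \<omega>) x *
      ennreal (1 / (support_fun K (radial_gauss K x) * deriv (\<Psi> (radial_gauss K x)) (support_fun K (radial_gauss K x))))
      = ?F (gauss_map K x)"
  proof (rule AE_mp, intro AE_I2 impI)
    fix x assume "x \<in> space lam" and x: "x \<notin> bad_directions K"
    then have xS: "x \<in> S" using sl by simp
    have g: "gauss_map K x = radial_gauss K x" using x by (simp add: gauss_map_def)
    \<comment> \<open>With a single normal, the normal set meets \<omega> exactly when the chosen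
      normal lies in \<omega>.\<close>
    have "radial_gauss_set K x = {radial_gauss K x}"
      using radial_gauss_mem[OF K xS] radial_gauss_set_singleton[OF K xS x] by blast
    then have "indicator (reverse_radial_gauss K \<omega>) x = (indicator \<omega> (radial_gauss K x) :: ennreal)"
      using xS by (simp add: reverse_radial_gauss_def indicator_def)
    then show "indicator (reverse_radial_gauss K \<omega>) x *
      ennreal (1 / (support_fun K (radial_gauss K x) * deriv (\<Psi> (radial_gauss K x)) (support_fun K (radial_gauss K x))))
      = ?F (gauss_map K x)"
      by (simp add: g w_def)
  qed
  \<comment> \<open>Congruence of \<open>nn_integral\<close> almost everywhere asks for no
    measurability, so the integrand with the arbitrary choice can be traded for a composition with
    \<open>gauss_map\<close>.\<close>
  then have "J_tilde \<Psi> lam K \<omega> = enn2real (\<integral>\<^sup>+x. ?F (gauss_map K x) \<partial>lam)"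
    unfolding J_tilde_def by (simp cong: nn_integral_cong_AE)
  also have "(\<integral>\<^sup>+x. ?F (gauss_map K x) \<partial>lam) = (\<integral>\<^sup>+u. ?F u \<partial>distr lam sphere_borel (gauss_map K))"
    using Fm by (subst nn_integral_distr[OF gauss_map_measurable[OF K lam]]) (simp_all only: measurable_distr_eq1)
  also have "\<dots> = (\<integral>\<^sup>+u. ?F u \<partial>density \<mu> (\<lambda>u. ennreal (\<kappa> * w K u)))"
    by (simp only: distr_gauss_map[OF K lam mu w k eq])
  also have "\<dots> = (\<integral>\<^sup>+u. ennreal (\<kappa> * w K u) * ?F u \<partial>\<mu>)"
    by (rule nn_integral_density[OF km Fm'])
  also have "\<dots> = (\<integral>\<^sup>+u. ennreal \<kappa> * indicator \<omega> u \<partial>\<mu>)"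
  proof (rule nn_integral_cong)
    fix u assume "u \<in> space \<mu>"
    then have "w K u > 0" using sm w by (simp add: pos_cont_def)
    then show "ennreal (\<kappa> * w K u) * ?F u = ennreal \<kappa> * indicator \<omega> u"
      using k by (auto simp: indicator_def simp flip: ennreal_mult)
  qed
  also have "\<dots> = ennreal \<kappa> * emeasure \<mu> \<omega>" by (rule nn_integral_cmult_indicator[OF \<omega>])
  finally show ?thesis using k by (simp add: enn2real_mult measure_def)
qed

lemma solution_exists:
  fixes \<Psi> :: "'a::euclidean_space \<Rightarrow> real \<Rightarrow> real"
  assumes G: "class_G_I \<Psi>" and lam: "class_M lam" and mu: "finite_borel_sphere_measure \<mu>"
    and nl: "not_concentrated_on_hemisphere lam" and nm: "not_concentrated_on_hemisphere \<mu>"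
  shows "\<exists>K. convex_body_o K \<and> solves_problem \<Psi> lam \<mu> K"
proof -
  have fl: "finite_borel_sphere_measure lam" using lam by (simp add: class_M_def)
  have sm: "space \<mu> = S" using mu by (simp add: finite_borel_sphere_measure_def)
  obtain K where K: "convex_body_o K"
    and min: "\<And>f. pos_cont f \<Longrightarrow> psi_cost \<Psi> \<mu> f \<le> psi_cost \<Psi> \<mu> (support_fun K) \<Longrightarrow>
      log_energy lam (support_fun K) \<le> log_energy lam f"
    using log_energy_minimizer_body[OF G fl mu nl nm] by metis
  obtain \<kappa> where k: "\<kappa> > 0"
    "\<And>g :: 'a \<Rightarrow> real. continuous_on S g \<Longrightarrow>
      (\<integral>x. g (gauss_map K x) \<partial>lam) = \<kappa> * (\<integral>u. support_fun K u * deriv (\<Psi> u) (support_fun K u) * g u \<partial>\<mu>)"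
    using proportional_functionals[OF G lam mu K min] by metis
  have "S \<in> sets \<mu>" using sets.top[of \<mu>] sm by simp
  then have "solves_problem \<Psi> lam \<mu> K"
    unfolding solves_problem_def using k(1) J_tilde_eq[OF G K lam mu k] by simp
  then show ?thesis using K by blast
qed

section \<open>Necessity of the hemisphere condition\<close>

lemma normals_near_direction:
  fixes K :: "'a::euclidean_space set"
  assumes K: "convex_body_o K"
  obtains \<delta> where "\<delta> > 0"
    "\<And>u x v. u \<in> S \<Longrightarrow> x \<in> S \<Longrightarrow> dist u x < \<delta> \<Longrightarrow> v \<in> radial_gauss_set K x \<Longrightarrow> u \<bullet> v > 0"
proof -
  let ?h = "support_fun K"
  have h: "pos_cont ?h" by (rule pos_cont_support_fun[OF K])
  obtain m M where m: "0 < m" "m \<le> M" "\<And>u. u \<in> S \<Longrightarrow> m \<le> ?h u" "\<And>u. u \<in> S \<Longrightarrow> ?h u \<le> M"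
    using pos_cont_bounds[OF h] by metis
  show thesis
  proof (rule that)
    \<comment> \<open>A normal v at direction x satisfies v . x at least h v / M, hence at least m /
      M, because the gauge of a unit vector is at least 1 / M. Moving from x to u loses at most
      their distance, so this radius works for every u.\<close>
    show "m / M > 0" using m by simp
    fix u x v assume u: "u \<in> S" and x: "x \<in> S" and d: "dist u x < m / M" and v: "v \<in> radial_gauss_set K x"
    have vS: "v \<in> S" "(v \<bullet> x) / ?h v = polar_gauge ?h x" using v radial_gauss_set_iff[OF K x] by auto
    have hv: "?h v > 0" using h vS by (simp add: pos_cont_def)
    have "1 / M \<le> (v \<bullet> x) / ?h v" using polar_gauge_ge_norm[OF h m(4), of x] x vS(2) by simp
    then have "?h v / M \<le> v \<bullet> x" using hv by (simp add: pos_le_divide_eq)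
    moreover have "m / M \<le> ?h v / M" using m vS(1) by (intro divide_right_mono) auto
    moreover have "v \<bullet> (x - u) \<le> dist u x"
      using norm_cauchy_schwarz[of v "x - u"] vS(1) by (simp add: dist_norm norm_minus_commute)
    moreover have "v \<bullet> (x - u) = v \<bullet> x - u \<bullet> v" by (simp add: inner_diff_right inner_commute)
    ultimately show "u \<bullet> v > 0" using d by linarith
  qed
qed

text \<open>If \<mu> missed the open hemisphere around u, then so would \<open>J_tilde\<close>. But
  every direction in a small cap around u has its normals in that hemisphere, the integrand is
  bounded below there, and \<open>lam\<close> charges the cap.\<close>

lemma solution_imp_not_concentrated:
  fixes \<Psi> :: "'a::euclidean_space \<Rightarrow> real \<Rightarrow> real"
  assumes G: "class_G_I \<Psi>" and lam: "finite_borel_sphere_measure lam" and mu: "finite_borel_sphere_measure \<mu>"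
    and pos: "\<And>U. openin (top_of_set S) U \<Longrightarrow> U \<noteq> {} \<Longrightarrow> emeasure lam U > 0"
    and K: "convex_body_o K" and sol: "solves_problem \<Psi> lam \<mu> K"
  shows "not_concentrated_on_hemisphere \<mu>"
  unfolding not_concentrated_on_hemisphere_def
proof (rule ballI, rule ccontr)
  fix u :: 'a assume u: "u \<in> S" and "\<not> (\<integral>\<xi>. max 0 (u \<bullet> \<xi>) \<partial>\<mu>) > 0"
  moreover have "(\<integral>\<xi>. max 0 (u \<bullet> \<xi>) \<partial>\<mu>) \<ge> 0" by (intro integral_nonneg_AE) auto
  ultimately have z: "(\<integral>\<xi>. max 0 (u \<bullet> \<xi>) \<partial>\<mu>) = 0" by linarith
  interpret M: finite_measure \<mu> using mu by (simp add: finite_borel_sphere_measure_def)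
  have sm: "space \<mu> = S" "emeasure \<mu> S \<noteq> 0" using mu by (simp_all add: finite_borel_sphere_measure_def)
  have sl: "space lam = S" "sets lam = sets sphere_borel" using lam by (simp_all add: finite_borel_sphere_measure_def)
  let ?\<omega> = "{v\<in>S. u \<bullet> v > 0}"
  have \<omega>: "?\<omega> \<in> sets \<mu>" by (rule sets_open_cap[OF mu])
  have "integrable \<mu> (\<lambda>\<xi>. max 0 (u \<bullet> \<xi>))"
    by (intro integrable_continuous_on_sphere[OF mu] continuous_intros)
  then have "AE \<xi> in \<mu>. max 0 (u \<bullet> \<xi>) = 0" using z by (subst integral_nonneg_eq_0_iff_AE[symmetric]) auto
  then have "AE \<xi> in \<mu>. \<xi> \<notin> ?\<omega>" by (rule AE_mp) (auto intro!: AE_I2)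
  then have "emeasure \<mu> ?\<omega> = 0"
    using AE_iff_measurable[OF \<omega>, of "\<lambda>\<xi>. \<xi> \<notin> ?\<omega>"] sm(1) by auto
  then have m0: "measure \<mu> ?\<omega> = 0" by (simp add: measure_def)
  define F where "F = (\<lambda>x. ennreal (1 / (support_fun K (radial_gauss K x) *
    deriv (\<Psi> (radial_gauss K x)) (support_fun K (radial_gauss K x)))))"
  define I where "I = (\<lambda>\<omega>. \<integral>\<^sup>+x. indicator (reverse_radial_gauss K \<omega>) x * F x \<partial>lam)"
  have J: "J_tilde \<Psi> lam K \<omega> = enn2real (I \<omega>)" for \<omega> by (simp add: J_tilde_def I_def F_def)
  have Ssets: "S \<in> sets \<mu>" using sets.top[of \<mu>] sm by simp
  have "measure \<mu> S \<noteq> 0" using sm(2) by (simp add: M.emeasure_eq_measure)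
  \<comment> \<open>Division by zero gives 0 and \<open>enn2real\<close> sends infinity to 0, so the
    quotient 1 on the whole sphere excludes both a vanishing and an infinite total integral.
    Finiteness is then what lets a zero value of \<open>enn2real\<close> mean a zero integral over
    the hemisphere.\<close>
  then have "J_tilde \<Psi> lam K S / J_tilde \<Psi> lam K S = 1"
    using sol Ssets unfolding solves_problem_def by (metis divide_self)
  then have JS: "enn2real (I S) \<noteq> 0" by (auto simp: J)
  have "J_tilde \<Psi> lam K ?\<omega> / J_tilde \<Psi> lam K S = 0"
    using sol \<omega> m0 unfolding solves_problem_def by (metis div_0)
  then have J\<omega>: "enn2real (I ?\<omega>) = 0" using JS by (simp add: J)
  have "I ?\<omega> \<le> I S"
    unfolding I_def by (intro nn_integral_mono mult_right_mono) (auto simp: indicator_def reverse_radial_gauss_def)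
  moreover have "I S < top" using JS by (cases "I S") auto
  ultimately have "I ?\<omega> < top" by (rule le_less_trans)
  then have I0: "I ?\<omega> = 0" using J\<omega> by (auto simp: enn2real_eq_0_iff)
  define w where "w = (\<lambda>v. support_fun K v * deriv (\<Psi> v) (support_fun K v))"
  have w: "pos_cont w"
    unfolding w_def by (rule pos_cont_weight[OF G pos_cont_support_fun[OF K]])
  obtain m M where m: "0 < m" "m \<le> M" "\<And>v. v \<in> S \<Longrightarrow> m \<le> w v" "\<And>v. v \<in> S \<Longrightarrow> w v \<le> M"
    using pos_cont_bounds[OF w] by metis
  obtain \<delta> where \<delta>: "\<delta> > 0"
    "\<And>u x v. u \<in> S \<Longrightarrow> x \<in> S \<Longrightarrow> dist u x < \<delta> \<Longrightarrow> v \<in> radial_gauss_set K x \<Longrightarrow> u \<bullet> v > 0"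
    using normals_near_direction[OF K] by metis
  define U where "U = S \<inter> ball u \<delta>"
  have U: "openin (top_of_set S) U" "U \<noteq> {}" "U \<in> sets lam"
  proof -
    show "openin (top_of_set S) U" by (simp add: U_def openin_open_Int)
    have "u \<in> U" using u \<delta>(1) by (simp add: U_def)
    then show "U \<noteq> {}" by blast
    show "U \<in> sets lam" unfolding sl(2) U_def by (simp add: sets_restrict_space)
  qed
  have "ennreal (1 / M) * emeasure lam U = (\<integral>\<^sup>+x. ennreal (1 / M) * indicator U x \<partial>lam)"
    by (rule nn_integral_cmult_indicator[OF U(3), symmetric])
  also have "\<dots> \<le> I ?\<omega>"
    unfolding I_def
  proof (rule nn_integral_mono)
    fix x assume "x \<in> space lam"
    then have x: "x \<in> S" using sl by simp
    show "ennreal (1 / M) * indicator U x \<le> indicator (reverse_radial_gauss K ?\<omega>) x * F x"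
    proof (cases "x \<in> U")
      case True
      let ?v = "radial_gauss K x"
      have v: "?v \<in> radial_gauss_set K x" "?v \<in> S"
        by (rule radial_gauss_mem[OF K x], rule radial_gauss_sphere[OF K x])
      have "u \<bullet> ?v > 0" using \<delta>(2)[OF u x _ v(1)] True by (simp add: U_def)
      then have r: "x \<in> reverse_radial_gauss K ?\<omega>"
        using v x unfolding reverse_radial_gauss_def by blast
      have "1 / M \<le> 1 / w ?v" using m v(2) by (intro frac_le) (auto intro: less_le_trans)
      then have "ennreal (1 / M) \<le> F x" by (simp add: F_def w_def ennreal_leI)
      then show ?thesis using r True by simp
    qed simp
  qed
  finally have "ennreal (1 / M) * emeasure lam U = 0" using I0 by simp
  moreover have "emeasure lam U \<noteq> 0" using pos[OF U(1,2)] by simp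
  ultimately show False using m by simp
qed

theorem theorem5p7:
  fixes \<Psi> :: "'a::euclidean_space \<Rightarrow> real \<Rightarrow> real"
    and lam \<mu> :: "'a measure"
  assumes "DIM('a) \<ge> 2"
    and "class_G_I \<Psi>"
    and "class_M lam"
    and "finite_borel_sphere_measure \<mu>"
  shows "(not_concentrated_on_hemisphere lam \<and> not_concentrated_on_hemisphere \<mu> \<longrightarrow>
            (\<exists>K. convex_body_o K \<and> solves_problem \<Psi> lam \<mu> K))
       \<and> ((\<forall>U. openin (top_of_set S) U \<and> U \<noteq> {} \<longrightarrow> emeasure lam U > 0) \<longrightarrow>
            (\<exists>K. convex_body_o K \<and> solves_problem \<Psi> lam \<mu> K) \<longrightarrow>
            not_concentrated_on_hemisphere \<mu>)"
proof (intro conjI impI)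
  assume "not_concentrated_on_hemisphere lam \<and> not_concentrated_on_hemisphere \<mu>"
  then show "\<exists>K. convex_body_o K \<and> solves_problem \<Psi> lam \<mu> K"
    using solution_exists[OF assms(2-4)] by blast
next
  assume pos: "\<forall>U. openin (top_of_set S) U \<and> U \<noteq> {} \<longrightarrow> emeasure lam U > 0"
    and "\<exists>K. convex_body_o K \<and> solves_problem \<Psi> lam \<mu> K"
  then obtain K where K: "convex_body_o K" "solves_problem \<Psi> lam \<mu> K" by blast
  have fl: "finite_borel_sphere_measure lam" using assms(3) by (simp add: class_M_def)
  show "not_concentrated_on_hemisphere \<mu>"
    by (rule solution_imp_not_concentrated[OF assms(2) fl assms(4) _ K]) (use pos in blast)
qed

end
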